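(* Let $(\mathbf{c}^\star,\bar{\mathbf\Sigma}_{ux}^\star,\bar{\mathbf\Sigma}_u^\star,\bar{\mathbf\Sigma}^\star)$ be an optimal solution of Problem (C) defined in the context, let $\bar\Sigma_{x_k}^\star$ be the corresponding matrices $\bar\Sigma_{x_k}$ (with $\bar\Sigma_{x_0}^\star=\Sigma_I$), and set $L_k^\star=\bar\Sigma_{ux_k}^\star(\bar\Sigma_{x_k}^\star)^{-1}$ for $k=0,\dots,N-1$. Then: (i) The control policy $\{c_k^\star,L_k^\star\}_{k=0}^{N-1}$ is a feasible solution of Problem (D) defined in the context when its terminal covariance constraint $\Sigma_{x_N}=\Sigma_F$ is relaxed to $\Sigma_{x_N}\preceq\Sigma_F$. (ii) Let $\mathbf u^\star=\{u_k^\star\}_{k=0}^{N-1}$ with $u_k^\star=L_k^\star\tilde x_k^\star+c_k^\star$, where for $k=0,\dots,N-1$ $$\tilde x_{k+1}^\star=(\bar A+\bar BL_k^\star)\tilde x_k^\star+\sum_{j=1}^m\tilde A_jq_{j,k}x_k^\star+\sum_{j=1}^m\tilde B_jq_{j,k}u_k^\star+\sum_{j=1}^m\tilde d_jq_{j,k},$$ $$x_{k+1}^\star=\Big(\bar A+\sum_{j=1}^m\tilde A_jq_{j,k}\Big)x_k^\star+\Big(\bar B+\sum_{j=1}^m\tilde B_jq_{j,k}\Big)u_k^\star+\bar d+\sum_{j=1}^m\tilde d_jq_{j,k},$$ $\bar x_{k+1}^\star=\bar A\bar x_k^\star+\bar B\bar u_k^\star+\bar d$, $\bar u_k^\star=c_k^\star$,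 with $\tilde x_0^\star=x_0-\mu_I$, $x_0^\star=x_0$, $\bar x_0^\star=\mu_I$. Then $\mathbf u^\star$ is a feasible solution of Problem (S) defined in the context when its terminal covariance constraint $\mathbb{E}[(x_N-\mathbb{E}[x_N])(x_N-\mathbb{E}[x_N])^\top]=\Sigma_F$ is relaxed to $\mathbb{E}[(x_N-\mathbb{E}[x_N])(x_N-\mathbb{E}[x_N])^\top]\preceq\Sigma_F$.
   Context: Data. Integers $N,m,n_x,n_u\ge 1$, $N_s,N_c\ge 0$; matrices $\bar A,\tilde A_j\in\mathbb{R}^{n_x\times n_x}$, $\bar B,\tilde B_j\in\mathbb{R}^{n_x\times n_u}$, vectors $\bar d,\tilde d_j\in\mathbb{R}^{n_x}$ ($j=1,\dots,m$); weight matrices $Q\in\mathbb{R}^{n_x\times n_x}$, $R\in\mathbb{R}^{n_u\times n_u}$. The initial state $x_0$ is a random vector in $\mathbb{R}^{n_x}$ with mean $\mu_I$ and covariance $\Sigma_I\succ0$. The noises $q_{j,k}\sim\mathcal N(0,1)$, $j=1,\dots,m$, $k=0,1,\dots$, are mutually independent and independent of $x_0$. Controls are causal, so that $x_k$ and $u_k$ are independent of the noises $q_{j,k}$ acting at time $k$. The target mean and covariance are $\mu_F\in\mathcal X$ and $\Sigma_F\succ0$. The constraint sets are $$\mathcal X=\bigcap_{i=1}^{N_s}\{x\in\mathbb{R}^{n_x}:\alpha_{x,i}^\top x\le\beta_{x,i}\},\qquad \mathcal U=\bigcap_{i=1}^{N_c}\{u\in\mathbb{R}^{n_u}:\alpha_{u,i}^\top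 u\le\beta_{u,i}\},$$ with fixed vectors $\alpha_{x,i}\in\mathbb{R}^{n_x}$, $\alpha_{u,i}\in\mathbb{R}^{n_u}$ and scalars $\beta_{x,i},\beta_{u,i}\ge0$. The risk levels are $p_x,p_u\in(0,0.5)$, and $p_{x,i},p_{u,i}>0$ are fixed numbers with $\sum_{i=1}^{N_s}p_{x,i}\le p_x$ and $\sum_{i=1}^{N_c}p_{u,i}\le p_u$. Fixed linearization points $\lambda_{x,i,k}>0$ ($i=1,\dots,N_s$) and $\lambda_{u,i,k}>0$ ($i=1,\dots,N_c$), $k=0,\dots,N-1$, are given. $\preceq,\succeq,\succ$ denote the Loewner order on symmetric matrices. Problem (S) (stochastic covariance steering). Minimize over control sequences $\{u_0,\dots,u_{N-1}\}$ the cost $\mathbb{E}\big[\sum_{k=0}^{N-1}x_k^\top Qx_k+u_k^\top Ru_k\big]$ subject to: $x_0$ has mean $\mu_I$ and covariance $\Sigma_I$; $$x_{k+1}=\Big(\bar A+\sum_{j=1}^m\tilde A_jq_{j,k}\Big)x_k+\Big(\bar B+\sum_{j=1}^m\tilde B_jq_{j,k}\Big)u_k+\bar d+\sum_{j=1}^m\tilde d_jq_{j,k},\quad k=0,\dots,N-1;$$ $\Pr(x_k\in\mathcal X)\ge1-p_x$ and $\Pr(u_k\in\mathcal U)\ge1-p_u$ for $k=0,\dots,N-1$; $\mathbb{E}[x_N]=\mu_F$; and $\mathbb{E}[(x_N-\mathbb{E}[x_N])(x_N-\mathbb{E}[x_N])^\top]=\Sigma_F$. Problem (D) (deterministic). Minimize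 over $\mathbf c=\{c_0,\dots,c_{N-1}\}$, $c_k\in\mathbb{R}^{n_u}$, and $\mathbf L=\{L_0,\dots,L_{N-1}\}$, $L_k\in\mathbb{R}^{n_u\times n_x}$, the cost $$\sum_{k=0}^{N-1}\bar x_k^\top Q\bar x_k+\mathrm{tr}(Q\Sigma_{x_k})+\bar u_k^\top R\bar u_k+\mathrm{tr}(R\Sigma_{u_k})$$ subject to, for all $k=0,\dots,N-1$, and all $i_x=1,\dots,N_s$, $i_u=1,\dots,N_c$: $\bar x_0=\mu_I$, $\Sigma_{x_0}=\Sigma_I$, $\bar x_{k+1}=\bar A\bar x_k+\bar B\bar u_k+\bar d$, $\bar u_k=c_k$, $\Sigma_{u_k}=L_k\Sigma_{x_k}L_k^\top$, $\Sigma_{x_ku_k}=\Sigma_{x_k}L_k^\top$, $$\begin{aligned}\Sigma_{x_{k+1}}=\;&\bar A\Sigma_{x_k}\bar A^\top+\bar A\Sigma_{x_ku_k}\bar B^\top+\bar B\Sigma_{x_ku_k}^\top\bar A^\top+\bar B\Sigma_{u_k}\bar B^\top\\&+\sum_{j=1}^m\big(\tilde A_j\Sigma_{x_k}\tilde A_j^\top+\tilde A_j\Sigma_{x_ku_k}\tilde B_j^\top+\tilde B_j\Sigma_{x_ku_k}^\top\tilde A_j^\top+\tilde B_j\Sigma_{u_k}\tilde B_j^\top\big)\\&+\sum_{j=1}^m(\tilde A_j\bar x_k+\tilde B_j\bar u_k+\tilde d_j)(\tilde A_j\bar x_k+\tilde B_j\bar u_k+\tilde d_j)^\top,\end{aligned}$$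 $$\alpha_{x,i_x}^\top\bar x_k+\sqrt{\alpha_{x,i_x}^\top\Sigma_{x_k}\alpha_{x,i_x}}\sqrt{\tfrac{1-p_{x,i_x}}{p_{x,i_x}}}-\beta_{x,i_x}\le0,\qquad \alpha_{u,i_u}^\top\bar u_k+\sqrt{\alpha_{u,i_u}^\top\Sigma_{u_k}\alpha_{u,i_u}}\sqrt{\tfrac{1-p_{u,i_u}}{p_{u,i_u}}}-\beta_{u,i_u}\le0,$$ $\bar x_N=\mu_F$, and $\Sigma_{x_N}=\Sigma_F$. Problem (C) (convex). Minimize over $\mathbf c=\{c_k\}_{k=0}^{N-1}$, $c_k\in\mathbb{R}^{n_u}$; $\bar{\mathbf\Sigma}_{ux}=\{\bar\Sigma_{ux_k}\}_{k=0}^{N-1}$, $\bar\Sigma_{ux_k}\in\mathbb{R}^{n_u\times n_x}$; $\bar{\mathbf\Sigma}_u=\{\bar\Sigma_{u_k}\}_{k=0}^{N-1}$, $\bar\Sigma_{u_k}\in\mathbb{R}^{n_u\times n_u}$ symmetric; and $\bar{\mathbf\Sigma}=\{\bar\Sigma_{jk}\}_{j=1,k=0}^{m,N-1}$, $\bar\Sigma_{jk}\in\mathbb{R}^{n_x\times n_x}$ symmetric, the cost $$\sum_{k=0}^{N-1}\bar x_k^\top Q\bar x_k+\mathrm{tr}(Q\bar\Sigma_{x_k})+\bar u_k^\top R\bar u_k+\mathrm{tr}(R\bar\Sigma_{u_k})$$ subject to, for all $k=0,\dots,N-1$, $j=1,\dots,m$, $i_x=1,\dots,N_s$, $i_u=1,\dots,N_c$: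 $\bar x_0=\mu_I$, $\bar\Sigma_{x_0}=\Sigma_I$, $\bar x_{k+1}=\bar A\bar x_k+\bar B\bar u_k+\bar d$, $\bar u_k=c_k$, $$\begin{aligned}\bar\Sigma_{x_{k+1}}=\;&\bar A\bar\Sigma_{x_k}\bar A^\top+\bar A\bar\Sigma_{ux_k}^\top\bar B^\top+\bar B\bar\Sigma_{ux_k}\bar A^\top+\bar B\bar\Sigma_{u_k}\bar B^\top\\&+\sum_{j=1}^m\big(\tilde A_j\bar\Sigma_{x_k}\tilde A_j^\top+\tilde A_j\bar\Sigma_{ux_k}^\top\tilde B_j^\top+\tilde B_j\bar\Sigma_{ux_k}\tilde A_j^\top+\tilde B_j\bar\Sigma_{u_k}\tilde B_j^\top+\bar\Sigma_{jk}\big),\end{aligned}$$ $$\bar\Sigma_{u_k}\succeq\bar\Sigma_{ux_k}\bar\Sigma_{x_k}^{-1}\bar\Sigma_{ux_k}^\top\quad(\text{with }\bar\Sigma_{x_k}\succ0),$$ $$\bar\Sigma_{jk}\succeq(\tilde A_j\bar x_k+\tilde B_j\bar u_k+\tilde d_j)(\tilde A_j\bar x_k+\tilde B_j\bar u_k+\tilde d_j)^\top,$$ $$\Big(\tfrac{\sqrt{\lambda_{x,i_x,k}}}{2}+\tfrac{1}{2\sqrt{\lambda_{x,i_x,k}}}\alpha_{x,i_x}^\top\bar\Sigma_{x_k}\alpha_{x,i_x}\Big)\sqrt{\tfrac{1-p_{x,i_x}}{p_{x,i_x}}}+\alpha_{x,i_x}^\top\bar x_k-\beta_{x,i_x}\le0,$$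 $$\Big(\tfrac{\sqrt{\lambda_{u,i_u,k}}}{2}+\tfrac{1}{2\sqrt{\lambda_{u,i_u,k}}}\alpha_{u,i_u}^\top\bar\Sigma_{u_k}\alpha_{u,i_u}\Big)\sqrt{\tfrac{1-p_{u,i_u}}{p_{u,i_u}}}+\alpha_{u,i_u}^\top\bar u_k-\beta_{u,i_u}\le0,$$ $\bar x_N=\mu_F$, and $\bar\Sigma_{x_N}\preceq\Sigma_F$. "Feasible" means satisfying all constraints of the problem. *)

theory Defs
  imports "HOL-Probability.Probability"
begin

section \<open>Loewner order, outer products and random vectors\<close>

definition psd :: "real^'n^'n \<Rightarrow> bool" where
  "psd A \<longleftrightarrow> transpose A = A \<and> (\<forall>v. 0 \<le> v \<bullet> (A *v v))"

definition pos_def :: "real^'n^'n \<Rightarrow> bool" where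
  "pos_def A \<longleftrightarrow> transpose A = A \<and> (\<forall>v. v \<noteq> 0 \<longrightarrow> 0 < v \<bullet> (A *v v))"

definition loewner_le :: "real^'n^'n \<Rightarrow> real^'n^'n \<Rightarrow> bool" where
  "loewner_le A B \<longleftrightarrow> transpose A = A \<and> transpose B = B \<and> psd (B - A)"

definition outer :: "real^'n \<Rightarrow> real^'n^'n" where
  "outer v = (\<chi> i j. v $ i * v $ j)"

definition quad :: "real^'n \<Rightarrow> real^'n^'n \<Rightarrow> real" where
  "quad v A = v \<bullet> (A *v v)"

text \<open>Bochner integrals of non-integrable functions are 0 by convention, so finiteness of the
  second moments is always demanded explicitly.\<close>

definition square_integrable_rv :: "'w measure \<Rightarrow> ('w \<Rightarrow> real^'n) \<Rightarrow> bool" where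
  "square_integrable_rv M X \<longleftrightarrow>
     X \<in> borel_measurable M \<and> integrable M (\<lambda>w. (norm (X w))\<^sup>2)"

definition mean :: "'w measure \<Rightarrow> ('w \<Rightarrow> real^'n) \<Rightarrow> real^'n" where
  "mean M X = (\<integral>w. X w \<partial>M)"

definition covariance :: "'w measure \<Rightarrow> ('w \<Rightarrow> real^'n) \<Rightarrow> real^'n^'n" where
  "covariance M X = (\<integral>w. outer (X w - mean M X) \<partial>M)"

definition polyhedron_of :: "nat \<Rightarrow> (nat \<Rightarrow> real^'n) \<Rightarrow> (nat \<Rightarrow> real) \<Rightarrow> (real^'n) set" where
  "polyhedron_of n \<alpha> \<beta> = (\<Inter>i\<in>{1..n}. {v. \<alpha> i \<bullet> v \<le> \<beta> i})"


section \<open>Problem data\<close>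

text \<open>The finite index types \<open>'x\<close> and \<open>'u\<close> stand for the state and input coordinates, and
  \<open>real^'u^'x\<close> is the type of \<open>n\<^sub>x \<times> n\<^sub>u\<close> matrices. The indices \<open>j\<close> and \<open>i\<close> start from 1, and
  time starts from 0; values of the data outside these ranges are never used.\<close>

record ('x::finite, 'u::finite) steering_data =
  horizon :: nat
  noise_dim :: nat
  Abar :: "real^'x^'x"
  Atil :: "nat \<Rightarrow> real^'x^'x"
  Bbar :: "real^'u^'x"
  Btil :: "nat \<Rightarrow> real^'u^'x"
  dbar :: "real^'x"
  dtil :: "nat \<Rightarrow> real^'x"
  Qcost :: "real^'x^'x"
  Rcost :: "real^'u^'u"
  \<mu>I :: "real^'x"
  \<Sigma>I :: "real^'x^'x"
  \<mu>F :: "real^'x"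
  \<Sigma>F :: "real^'x^'x"
  num_x :: nat
  \<alpha>x :: "nat \<Rightarrow> real^'x"
  \<beta>x :: "nat \<Rightarrow> real"
  num_u :: nat
  \<alpha>u :: "nat \<Rightarrow> real^'u"
  \<beta>u :: "nat \<Rightarrow> real"
  risk_x :: real
  risk_u :: real
  prisk_x :: "nat \<Rightarrow> real"
  prisk_u :: "nat \<Rightarrow> real"
  lin_x :: "nat \<Rightarrow> nat \<Rightarrow> real"
  lin_u :: "nat \<Rightarrow> nat \<Rightarrow> real"

definition state_set :: "('x::finite, 'u::finite) steering_data \<Rightarrow> (real^'x) set" where
  "state_set P = polyhedron_of (num_x P) (\<alpha>x P) (\<beta>x P)"

definition input_set :: "('x::finite, 'u::finite) steering_data \<Rightarrow> (real^'u) set" where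
  "input_set P = polyhedron_of (num_u P) (\<alpha>u P) (\<beta>u P)"

definition valid_data :: "('x::finite, 'u::finite) steering_data \<Rightarrow> bool" where
  "valid_data P \<longleftrightarrow>
     1 \<le> horizon P \<and> 1 \<le> noise_dim P \<and>
     pos_def (\<Sigma>I P) \<and> pos_def (\<Sigma>F P) \<and> \<mu>F P \<in> state_set P \<and>
     (\<forall>i\<in>{1..num_x P}. 0 \<le> \<beta>x P i \<and> 0 < prisk_x P i) \<and>
     (\<forall>i\<in>{1..num_u P}. 0 \<le> \<beta>u P i \<and> 0 < prisk_u P i) \<and>
     0 < risk_x P \<and> risk_x P < 1/2 \<and> (\<Sum>i=1..num_x P. prisk_x P i) \<le> risk_x P \<and>
     0 < risk_u P \<and> risk_u P < 1/2 \<and> (\<Sum>i=1..num_u P. prisk_u P i) \<le> risk_u P \<and>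
     (\<forall>k<horizon P. \<forall>i\<in>{1..num_x P}. 0 < lin_x P i k) \<and>
     (\<forall>k<horizon P. \<forall>i\<in>{1..num_u P}. 0 < lin_u P i k)"

definition initial_state_law ::
  "('x::finite, 'u::finite) steering_data \<Rightarrow> 'w measure \<Rightarrow> ('w \<Rightarrow> real^'x) \<Rightarrow> bool" where
  "initial_state_law P M X \<longleftrightarrow>
     square_integrable_rv M X \<and> mean M X = \<mu>I P \<and> covariance M X = \<Sigma>I P"

definition noise_index :: "('x::finite, 'u::finite) steering_data \<Rightarrow> (nat \<times> nat) set" where
  "noise_index P = {1..noise_dim P} \<times> UNIV"

text \<open>The whole noise family is mutually independent, and as one (infinite-dimensional) random
  variable it is independent of the initial state. The library's \<open>indep_var\<close> needs both variables
  to have the same type, so the generated sigma-algebras are compared directly.\<close>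

definition valid_randomness ::
  "('x::finite, 'u::finite) steering_data \<Rightarrow> 'w measure \<Rightarrow> ('w \<Rightarrow> real^'x) \<Rightarrow>
   (nat \<Rightarrow> nat \<Rightarrow> 'w \<Rightarrow> real) \<Rightarrow> bool" where
  "valid_randomness P M x0 q \<longleftrightarrow>
     prob_space M \<and> initial_state_law P M x0 \<and>
     (\<forall>j\<in>{1..noise_dim P}. \<forall>k. distributed M lborel (q j k) (normal_density 0 1)) \<and>
     prob_space.indep_vars M (\<lambda>_. borel) (\<lambda>(j, k). q j k) (noise_index P) \<and>
     prob_space.indep_set M (sets (vimage_algebra (space M) x0 borel))
       (sets (vimage_algebra (space M) (\<lambda>w. \<lambda>(j, k)\<in>noise_index P. q j k w)
               (PiM (noise_index P) (\<lambda>_. borel))))"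


section \<open>The stochastic problem\<close>

primrec state ::
  "('x::finite, 'u::finite) steering_data \<Rightarrow> ('w \<Rightarrow> real^'x) \<Rightarrow> (nat \<Rightarrow> nat \<Rightarrow> 'w \<Rightarrow> real) \<Rightarrow>
   (nat \<Rightarrow> 'w \<Rightarrow> real^'u) \<Rightarrow> nat \<Rightarrow> 'w \<Rightarrow> real^'x" where
  "state P x0 q u 0 = x0"
| "state P x0 q u (Suc k) = (\<lambda>w.
     (Abar P + (\<Sum>j=1..noise_dim P. q j k w *\<^sub>R Atil P j)) *v state P x0 q u k w
   + (Bbar P + (\<Sum>j=1..noise_dim P. q j k w *\<^sub>R Btil P j)) *v u k w
   + dbar P + (\<Sum>j=1..noise_dim P. q j k w *\<^sub>R dtil P j))"

text \<open>The information available at time \<open>k\<close>: the sigma-algebra generated by the initial state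
  and the noises acting strictly before time \<open>k\<close>. A control that is measurable with respect to
  it, and hence also the state at time \<open>k\<close>, is independent of the noises acting at time \<open>k\<close>.\<close>

definition information ::
  "('x::finite, 'u::finite) steering_data \<Rightarrow> 'w measure \<Rightarrow> ('w \<Rightarrow> real^'x) \<Rightarrow>
   (nat \<Rightarrow> nat \<Rightarrow> 'w \<Rightarrow> real) \<Rightarrow> nat \<Rightarrow> 'w measure" where
  "information P M x0 q k = sigma (space M)
     ({x0 -` S \<inter> space M | S. S \<in> sets borel} \<union>
      {q j l -` S \<inter> space M | j l S. j \<in> {1..noise_dim P} \<and> l < k \<and> S \<in> sets borel})"

text \<open>The argument \<open>rel\<close> relates the terminal covariance to its target: it is equality in the
  original problem and the Loewner order in the relaxed one.\<close>

definition feasible_S ::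
  "(real^'x^'x \<Rightarrow> real^'x^'x \<Rightarrow> bool) \<Rightarrow> ('x::finite, 'u::finite) steering_data \<Rightarrow>
   'w measure \<Rightarrow> ('w \<Rightarrow> real^'x) \<Rightarrow> (nat \<Rightarrow> nat \<Rightarrow> 'w \<Rightarrow> real) \<Rightarrow>
   (nat \<Rightarrow> 'w \<Rightarrow> real^'u) \<Rightarrow> bool" where
  "feasible_S rel P M x0 q u \<longleftrightarrow>
     (\<forall>k<horizon P. u k \<in> borel_measurable (information P M x0 q k)
        \<and> square_integrable_rv M (u k)) \<and>
     initial_state_law P M (state P x0 q u 0) \<and>
     (\<forall>k<horizon P.
        measure M {w \<in> space M. state P x0 q u k w \<in> state_set P} \<ge> 1 - risk_x P \<and>
        measure M {w \<in> space M. u k w \<in> input_set P} \<ge> 1 - risk_u P) \<and>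
     square_integrable_rv M (state P x0 q u (horizon P)) \<and>
     mean M (state P x0 q u (horizon P)) = \<mu>F P \<and>
     rel (covariance M (state P x0 q u (horizon P))) (\<Sigma>F P)"

definition cost_S ::
  "('x::finite, 'u::finite) steering_data \<Rightarrow> 'w measure \<Rightarrow> ('w \<Rightarrow> real^'x) \<Rightarrow>
   (nat \<Rightarrow> nat \<Rightarrow> 'w \<Rightarrow> real) \<Rightarrow> (nat \<Rightarrow> 'w \<Rightarrow> real^'u) \<Rightarrow> real" where
  "cost_S P M x0 q u = (\<integral>w. (\<Sum>k<horizon P.
     quad (state P x0 q u k w) (Qcost P) + quad (u k w) (Rcost P)) \<partial>M)"


section \<open>The deterministic problem\<close>

primrec xbar ::
  "('x::finite, 'u::finite) steering_data \<Rightarrow> (nat \<Rightarrow> real^'u) \<Rightarrow> nat \<Rightarrow> real^'x" where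
  "xbar P c 0 = \<mu>I P"
| "xbar P c (Suc k) = Abar P *v xbar P c k + Bbar P *v c k + dbar P"

definition noise_gain ::
  "('x::finite, 'u::finite) steering_data \<Rightarrow> (nat \<Rightarrow> real^'u) \<Rightarrow> nat \<Rightarrow> nat \<Rightarrow> real^'x" where
  "noise_gain P c j k = Atil P j *v xbar P c k + Btil P j *v c k + dtil P j"

text \<open>One step of the covariance recursion, without the additive noise term. The argument \<open>Sux\<close> is the
  cross-covariance of input and state, i.e. the transpose of \<open>\<Sigma>\<^bsub>xu\<^esub>\<close>.\<close>

definition cov_step ::
  "('x::finite, 'u::finite) steering_data \<Rightarrow> real^'x^'x \<Rightarrow> real^'x^'u \<Rightarrow> real^'u^'u \<Rightarrow> real^'x^'x"
  where
  "cov_step P Sx Sux Su =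
     Abar P ** Sx ** transpose (Abar P) + Abar P ** transpose Sux ** transpose (Bbar P)
   + Bbar P ** Sux ** transpose (Abar P) + Bbar P ** Su ** transpose (Bbar P)
   + (\<Sum>j=1..noise_dim P.
        Atil P j ** Sx ** transpose (Atil P j) + Atil P j ** transpose Sux ** transpose (Btil P j)
      + Btil P j ** Sux ** transpose (Atil P j) + Btil P j ** Su ** transpose (Btil P j))"

primrec covD ::
  "('x::finite, 'u::finite) steering_data \<Rightarrow> (nat \<Rightarrow> real^'u) \<Rightarrow> (nat \<Rightarrow> real^'x^'u) \<Rightarrow> nat \<Rightarrow>
   real^'x^'x" where
  "covD P c L 0 = \<Sigma>I P"
| "covD P c L (Suc k) =
     (let Sx = covD P c L k; Sxu = Sx ** transpose (L k); Su = L k ** Sx ** transpose (L k)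
      in cov_step P Sx (transpose Sxu) Su + (\<Sum>j=1..noise_dim P. outer (noise_gain P c j k)))"

definition covDu ::
  "('x::finite, 'u::finite) steering_data \<Rightarrow> (nat \<Rightarrow> real^'u) \<Rightarrow> (nat \<Rightarrow> real^'x^'u) \<Rightarrow> nat \<Rightarrow>
   real^'u^'u" where
  "covDu P c L k = L k ** covD P c L k ** transpose (L k)"

definition feasible_D ::
  "(real^'x^'x \<Rightarrow> real^'x^'x \<Rightarrow> bool) \<Rightarrow> ('x::finite, 'u::finite) steering_data \<Rightarrow>
   (nat \<Rightarrow> real^'u) \<Rightarrow> (nat \<Rightarrow> real^'x^'u) \<Rightarrow> bool" where
  "feasible_D rel P c L \<longleftrightarrow>
     (\<forall>k<horizon P. \<forall>i\<in>{1..num_x P}.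
        \<alpha>x P i \<bullet> xbar P c k
        + sqrt (quad (\<alpha>x P i) (covD P c L k)) * sqrt ((1 - prisk_x P i) / prisk_x P i)
        - \<beta>x P i \<le> 0) \<and>
     (\<forall>k<horizon P. \<forall>i\<in>{1..num_u P}.
        \<alpha>u P i \<bullet> c k
        + sqrt (quad (\<alpha>u P i) (covDu P c L k)) * sqrt ((1 - prisk_u P i) / prisk_u P i)
        - \<beta>u P i \<le> 0) \<and>
     xbar P c (horizon P) = \<mu>F P \<and>
     rel (covD P c L (horizon P)) (\<Sigma>F P)"

definition cost_D ::
  "('x::finite, 'u::finite) steering_data \<Rightarrow> (nat \<Rightarrow> real^'u) \<Rightarrow> (nat \<Rightarrow> real^'x^'u) \<Rightarrow> real" where
  "cost_D P c L = (\<Sum>k<horizon P.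
     quad (xbar P c k) (Qcost P) + trace (Qcost P ** covD P c L k)
   + quad (c k) (Rcost P) + trace (Rcost P ** covDu P c L k))"


section \<open>The convex problem\<close>

primrec covC ::
  "('x::finite, 'u::finite) steering_data \<Rightarrow> (nat \<Rightarrow> real^'x^'u) \<Rightarrow> (nat \<Rightarrow> real^'u^'u) \<Rightarrow>
   (nat \<Rightarrow> nat \<Rightarrow> real^'x^'x) \<Rightarrow> nat \<Rightarrow> real^'x^'x" where
  "covC P Sux Su S 0 = \<Sigma>I P"
| "covC P Sux Su S (Suc k) =
     cov_step P (covC P Sux Su S k) (Sux k) (Su k) + (\<Sum>j=1..noise_dim P. S j k)"

definition feasible_C ::
  "('x::finite, 'u::finite) steering_data \<Rightarrow> (nat \<Rightarrow> real^'u) \<Rightarrow> (nat \<Rightarrow> real^'x^'u) \<Rightarrow>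
   (nat \<Rightarrow> real^'u^'u) \<Rightarrow> (nat \<Rightarrow> nat \<Rightarrow> real^'x^'x) \<Rightarrow> bool" where
  "feasible_C P c Sux Su S \<longleftrightarrow>
     (\<forall>k<horizon P. transpose (Su k) = Su k) \<and>
     (\<forall>k<horizon P. \<forall>j\<in>{1..noise_dim P}. transpose (S j k) = S j k) \<and>
     (\<forall>k<horizon P. pos_def (covC P Sux Su S k) \<and>
        loewner_le (Sux k ** matrix_inv (covC P Sux Su S k) ** transpose (Sux k)) (Su k)) \<and>
     (\<forall>k<horizon P. \<forall>j\<in>{1..noise_dim P}. loewner_le (outer (noise_gain P c j k)) (S j k)) \<and>
     (\<forall>k<horizon P. \<forall>i\<in>{1..num_x P}.
        (sqrt (lin_x P i k) / 2
         + 1 / (2 * sqrt (lin_x P i k)) * quad (\<alpha>x P i) (covC P Sux Su S k))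
          * sqrt ((1 - prisk_x P i) / prisk_x P i)
        + \<alpha>x P i \<bullet> xbar P c k - \<beta>x P i \<le> 0) \<and>
     (\<forall>k<horizon P. \<forall>i\<in>{1..num_u P}.
        (sqrt (lin_u P i k) / 2
         + 1 / (2 * sqrt (lin_u P i k)) * quad (\<alpha>u P i) (Su k))
          * sqrt ((1 - prisk_u P i) / prisk_u P i)
        + \<alpha>u P i \<bullet> c k - \<beta>u P i \<le> 0) \<and>
     xbar P c (horizon P) = \<mu>F P \<and>
     loewner_le (covC P Sux Su S (horizon P)) (\<Sigma>F P)"

definition cost_C ::
  "('x::finite, 'u::finite) steering_data \<Rightarrow> (nat \<Rightarrow> real^'u) \<Rightarrow> (nat \<Rightarrow> real^'x^'u) \<Rightarrow>
   (nat \<Rightarrow> real^'u^'u) \<Rightarrow> (nat \<Rightarrow> nat \<Rightarrow> real^'x^'x) \<Rightarrow> real" where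
  "cost_C P c Sux Su S = (\<Sum>k<horizon P.
     quad (xbar P c k) (Qcost P) + trace (Qcost P ** covC P Sux Su S k)
   + quad (c k) (Rcost P) + trace (Rcost P ** Su k))"

definition optimal_C ::
  "('x::finite, 'u::finite) steering_data \<Rightarrow> (nat \<Rightarrow> real^'u) \<Rightarrow> (nat \<Rightarrow> real^'x^'u) \<Rightarrow>
   (nat \<Rightarrow> real^'u^'u) \<Rightarrow> (nat \<Rightarrow> nat \<Rightarrow> real^'x^'x) \<Rightarrow> bool" where
  "optimal_C P c Sux Su S \<longleftrightarrow> feasible_C P c Sux Su S \<and>
     (\<forall>c' Sux' Su' S'. feasible_C P c' Sux' Su' S' \<longrightarrow>
        cost_C P c Sux Su S \<le> cost_C P c' Sux' Su' S')"

end

theory Submission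
  imports Defs
begin

text \<open>Fix a feasible point of the convex problem and let \<open>L k = Sux k ** matrix_inv (covC k)\<close> be the
recovered gains. The convex problem relaxes two equalities of the deterministic one: the input covariance
\<open>Su k\<close> need only dominate the value produced by the feedback \<open>L k\<close>, and the matrices \<open>S j k\<close> need only
dominate the rank-one noise terms. In closed-loop form one covariance step is a sum of congruences
\<open>S \<mapsto> K S K\<^sup>T\<close>, hence monotone for the Loewner order, and the two relaxations only
add positive semidefinite terms. Therefore the true covariance \<open>covD\<close> lies below \<open>covC\<close> at all times
(\<open>feasible_C_covariance_bounds\<close>). The terminal inequality is inherited, and the square roots in the
state and input constraints lie below their tangents, which are the linearized constraints of the
convex problem; this gives \<open>feasible_C_imp_feasible_D\<close>.

For the stochastic problem, the state at time \<open>k\<close> is a function of the initial state and of earlier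
noises, so it is independent of the noises acting at time \<open>k\<close> (\<open>indep_info_present\<close>). Those noises
together with the constant one form an orthonormal family, so all mixed terms in the second moments
of the next state vanish (\<open>white_sum_moments\<close>). It follows that \<open>xbar\<close> and \<open>covD\<close> are the exact
mean and covariance of the closed-loop state (\<open>feedback_state_moments\<close>), and the terminal conditions
carry over. The state need not be Gaussian, but Cantelli's inequality bounds the probability of violating a
half-space by means and variances alone, and a union bound over the faces completes the chance
constraints (\<open>chance_constraint_halfspace\<close>, \<open>chance_constraint_polyhedron\<close>).\<close>

section \<open>Congruence of matrices and the Loewner order\<close>

definition congruence :: "real^'n^'m \<Rightarrow> real^'n^'n \<Rightarrow> real^'m^'m" where
  "congruence K S = K ** S ** transpose K"

lemma transpose_add: "transpose (A + B) = transpose A + transpose B"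
  by (simp add: transpose_def vec_eq_iff)

lemma transpose_zero: "transpose (0::real^'n^'m) = 0"
  by (simp add: transpose_def vec_eq_iff)

lemma matrix_add_rdistrib: "(A + B) ** C = A ** C + B ** (C::real^'n^'k)"
  by (simp add: matrix_matrix_mult_def vec_eq_iff sum.distrib algebra_simps)

lemma matrix_mult_diff_right: "A ** (B - C) = A ** B - A ** (C::real^'n^'k)"
  using matrix_add_ldistrib[of A "B - C" C] by (simp add: eq_diff_eq)

lemma matrix_mult_diff_left: "(A - B) ** C = A ** C - B ** (C::real^'n^'k)"
  using matrix_add_rdistrib[of "A - B" B C] by (simp add: eq_diff_eq)

lemma congruence_diff: "congruence K (S - T) = congruence K S - congruence K T"
  by (simp add: congruence_def matrix_mult_diff_left matrix_mult_diff_right)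

lemma transpose_congruence:
  "transpose S = S \<Longrightarrow> transpose (congruence K S) = congruence K S"
  by (simp add: congruence_def matrix_transpose_mul matrix_mul_assoc)

lemma transpose_outer: "transpose (outer v) = outer v"
  by (simp add: outer_def transpose_def vec_eq_iff)

lemma outer_mult_vector: "outer v *v w = (v \<bullet> w) *\<^sub>R v"
  by (simp add: outer_def vec_eq_iff matrix_vector_mult_def inner_vec_def sum_distrib_left
      mult_ac)

lemma inner_matrix_mult_right: "u \<bullet> (A *v v) = (transpose A *v u) \<bullet> (v::real^'n)"
  by (simp add: dot_lmul_matrix)

lemma inner_congruence:
  "u \<bullet> (congruence K S *v v) = (transpose K *v u) \<bullet> (S *v (transpose K *v v))"
  by (simp add: congruence_def matrix_vector_mul_assoc[symmetric] inner_matrix_mult_right[of u K]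
      del: transpose_matrix_vector)

lemma quad_add: "quad v (A + B) = quad v A + quad v B"
  by (simp add: quad_def matrix_vector_mult_add_rdistrib inner_right_distrib)

lemma psd_add: "psd A \<Longrightarrow> psd B \<Longrightarrow> psd (A + B)"
  using quad_add[of _ A B] by (simp add: psd_def transpose_add quad_def)

lemma psd_zero: "psd 0"
  by (simp add: psd_def transpose_zero)

lemma psd_sum: "(\<And>i. i \<in> I \<Longrightarrow> psd (F i)) \<Longrightarrow> psd (\<Sum>i\<in>I. F i)"
  by (induction I rule: infinite_finite_induct) (auto simp: psd_zero psd_add)

lemma psd_congruence: "psd S \<Longrightarrow> psd (congruence K S)"
  by (simp add: psd_def transpose_congruence inner_congruence del: transpose_matrix_vector)

lemma psd_outer: "psd (outer v)"
  by (simp add: psd_def transpose_outer outer_mult_vector inner_commute)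

lemma pos_def_imp_psd: "pos_def A \<Longrightarrow> psd A"
  unfolding psd_def pos_def_def by (metis inner_zero_left less_imp_le order_refl)

lemma pos_def_imp_invertible:
  assumes "pos_def A" shows "invertible A"
proof -
  have "x = 0" if "A *v x = 0" for x
    using assms that by (force simp: pos_def_def)
  then show ?thesis
    by (simp add: invertible_left_inverse matrix_left_invertible_ker)
qed

lemma matrix_inv_left_cancel:
  "invertible A \<Longrightarrow> matrix_inv A ** A = mat 1"
  unfolding invertible_def matrix_inv_def by (rule someI2_ex) auto

lemma loewner_le_refl: "transpose A = A \<Longrightarrow> loewner_le A A"
  by (simp add: loewner_le_def psd_zero)

lemma loewner_le_trans: "loewner_le A B \<Longrightarrow> loewner_le B C \<Longrightarrow> loewner_le A C"
  using psd_add[of "B - A" "C - B"] by (simp add: loewner_le_def)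

lemma loewner_le_congruence:
  "loewner_le A B \<Longrightarrow> loewner_le (congruence K A) (congruence K B)"
  using psd_congruence[of "B - A" K]
  by (simp add: loewner_le_def transpose_congruence congruence_diff)

lemma loewner_le_quad: "loewner_le A B \<Longrightarrow> quad v A \<le> quad v B"
  unfolding loewner_le_def psd_def quad_def
  by (metis diff_ge_0_iff_ge inner_diff_right matrix_vector_mult_diff_rdistrib)

section \<open>The covariance recursion under linear feedback\<close>

definition closed_loop_step ::
  "('x::finite, 'u::finite) steering_data \<Rightarrow> real^'x^'u \<Rightarrow> real^'x^'x \<Rightarrow> real^'x^'x" where
  "closed_loop_step P L S = congruence (Abar P + Bbar P ** L) S
     + (\<Sum>j=1..noise_dim P. congruence (Atil P j + Btil P j ** L) S)"

definition input_step ::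
  "('x::finite, 'u::finite) steering_data \<Rightarrow> real^'u^'u \<Rightarrow> real^'x^'x" where
  "input_step P D = congruence (Bbar P) D + (\<Sum>j=1..noise_dim P. congruence (Btil P j) D)"

text \<open>Completing the square. With the cross-covariance \<open>L ** S\<close> of a linear feedback the four mixed
terms factor through \<open>A + B ** L\<close>, and any input covariance beyond the feedback value
\<open>congruence L S\<close> enters only through \<open>B\<close>. Hence an excess \<open>D\<close> that is positive semidefinite can
only enlarge the next state covariance.\<close>
lemma congruence_feedback:
  assumes "transpose S = S"
  shows "A ** S ** transpose A + A ** transpose (L ** S) ** transpose B
           + B ** (L ** S) ** transpose A + B ** (congruence L S + D) ** transpose B
         = congruence (A + B ** L) S + congruence B D"
  using assms
  by (simp add: congruence_def matrix_add_ldistrib matrix_add_rdistrib matrix_mul_assoc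
      matrix_transpose_mul transpose_add)

lemma cov_step_feedback:
  assumes "transpose S = S"
  shows "cov_step P S (L ** S) (congruence L S + D) = closed_loop_step P L S + input_step P D"
  unfolding cov_step_def closed_loop_step_def input_step_def congruence_feedback[OF assms]
  by (simp add: sum.distrib)

lemma psd_closed_loop_step: "psd S \<Longrightarrow> psd (closed_loop_step P L S)"
  unfolding closed_loop_step_def by (intro psd_add psd_sum psd_congruence)

lemma psd_input_step: "psd D \<Longrightarrow> psd (input_step P D)"
  unfolding input_step_def by (intro psd_add psd_sum psd_congruence)

lemma closed_loop_step_diff:
  "closed_loop_step P L (S - T) = closed_loop_step P L S - closed_loop_step P L T"
  by (simp add: closed_loop_step_def congruence_diff sum_subtractf)

lemma congruence_zero: "congruence K 0 = 0"
  using congruence_diff[of K 0 0] by simp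

text \<open>Positive semidefiniteness and the closed-loop form are proved together: rewriting one step needs
the current covariance to be symmetric, and that is part of the induction hypothesis.\<close>
lemma psd_covD:
  assumes "psd (\<Sigma>I P)"
  shows "psd (covD P c L k)"
    and covD_Suc_closed_loop:
      "covD P c L (Suc k) = closed_loop_step P (L k) (covD P c L k)
         + (\<Sum>j=1..noise_dim P. outer (noise_gain P c j k))"
proof -
  have step: "covD P c L (Suc k) = closed_loop_step P (L k) (covD P c L k)
         + (\<Sum>j=1..noise_dim P. outer (noise_gain P c j k))" if "psd (covD P c L k)" for k
  proof -
    have sym: "transpose (covD P c L k) = covD P c L k"
      using that by (simp add: psd_def)
    have "transpose (covD P c L k ** transpose (L k)) = L k ** covD P c L k"
      by (simp add: matrix_transpose_mul sym)
    with cov_step_feedback[OF sym, of P "L k" 0] show ?thesis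
      by (simp add: Let_def congruence_def[symmetric] input_step_def congruence_zero)
  qed
  show *: "psd (covD P c L k)" for k
  proof (induction k)
    case 0
    then show ?case using assms by simp
  next
    case (Suc k)
    then show ?case
      unfolding step[OF Suc]
      by (intro psd_add psd_closed_loop_step psd_sum psd_outer)
  qed
  from step[OF *] show "covD P c L (Suc k) = closed_loop_step P (L k) (covD P c L k)
         + (\<Sum>j=1..noise_dim P. outer (noise_gain P c j k))" .
qed

text \<open>The two relaxed constraints of the convex problem both have a sign. Since \<open>L k ** covC k = Sux k\<close>,
the Schur complement constraint says that \<open>Su k\<close> dominates the covariance that the feedback
\<open>L k\<close> produces from \<open>covC k\<close>, and \<open>S j k\<close> dominates the additive noise term. The recursion is monotone
in the state covariance, the excess input covariance and the additive terms, so by induction the true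
covariance stays below the relaxed one.\<close>
lemma feasible_C_covariance_bounds:
  assumes "psd (\<Sigma>I P)" and feas: "feasible_C P c Sux Su S"
    and L: "\<And>k. k < horizon P \<Longrightarrow> L k = Sux k ** matrix_inv (covC P Sux Su S k)"
  shows "k < horizon P \<Longrightarrow> loewner_le (congruence (L k) (covC P Sux Su S k)) (Su k)"
    and "k \<le> horizon P \<Longrightarrow> loewner_le (covD P c L k) (covC P Sux Su S k)"
proof -
  let ?C = "covC P Sux Su S" and ?D = "covD P c L"
  have pd: "pos_def (?C k)" if "k < horizon P" for k
    using feas that by (simp add: feasible_C_def)
  have gain: "L k ** ?C k = Sux k" if "k < horizon P" for k
    using pos_def_imp_invertible[OF pd[OF that]] L[OF that]
    by (simp add: matrix_mul_assoc[symmetric] matrix_inv_left_cancel)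
  have sym: "transpose (?C k) = ?C k" if "k < horizon P" for k
    using pd[OF that] by (simp add: pos_def_def)
  have Su: "loewner_le (congruence (L k) (?C k)) (Su k)" if "k < horizon P" for k
  proof -
    have "Sux k ** transpose (L k) = Sux k ** matrix_inv (?C k) ** transpose (Sux k)"
    proof -
      have "Sux k ** transpose (L k) = L k ** (?C k ** transpose (L k))"
        by (simp add: gain[OF that, symmetric] matrix_mul_assoc)
      also have "?C k ** transpose (L k) = transpose (Sux k)"
        by (simp add: gain[OF that, symmetric] matrix_transpose_mul sym[OF that])
      finally show ?thesis by (simp add: L[OF that])
    qed
    then show ?thesis
      using feas that by (simp add: feasible_C_def congruence_def gain)
  qed
  then show "k < horizon P \<Longrightarrow> loewner_le (congruence (L k) (?C k)) (Su k)" .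
  show "loewner_le (?D k) (?C k)" if "k \<le> horizon P" using that
  proof (induction k)
    case 0
    then show ?case using assms(1) by (simp add: loewner_le_refl psd_def)
  next
    case (Suc k)
    then have k: "k < horizon P" and IH: "psd (?C k - ?D k)"
      by (simp_all add: loewner_le_def)
    define D where "D = Su k - congruence (L k) (?C k)"
    have D: "psd D" using Su[OF k] by (simp add: D_def loewner_le_def)
    have G: "psd (S j k - outer (noise_gain P c j k))" if "j \<in> {1..noise_dim P}" for j
      using feas k that by (simp add: feasible_C_def loewner_le_def)
    have "?C (Suc k) = closed_loop_step P (L k) (?C k) + input_step P D
            + (\<Sum>j=1..noise_dim P. S j k)"
      using cov_step_feedback[OF sym[OF k], of P "L k" D] by (simp add: gain[OF k] D_def)
    then have eq: "?C (Suc k) - ?D (Suc k) = closed_loop_step P (L k) (?C k - ?D k)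
        + input_step P D + (\<Sum>j=1..noise_dim P. S j k - outer (noise_gain P c j k))"
      by (simp add: covD_Suc_closed_loop[OF assms(1)] closed_loop_step_diff sum_subtractf
          del: covD.simps covC.simps)
    have diff: "psd (?C (Suc k) - ?D (Suc k))"
      unfolding eq using D G IH
      by (intro psd_add psd_closed_loop_step psd_input_step psd_sum)
    \<comment> \<open>The Loewner order includes symmetry of both sides; for \<open>covC\<close> it follows from that of
      \<open>covC - covD\<close> and \<open>covD\<close>, because at the final time positive definiteness is not available.\<close>
    have symD: "transpose (?D (Suc k)) = ?D (Suc k)"
      using psd_covD[OF assms(1)] unfolding psd_def by blast
    have "transpose (?C (Suc k)) = transpose (?C (Suc k) - ?D (Suc k)) + transpose (?D (Suc k))"
      unfolding transpose_add[symmetric] by simp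
    also have "\<dots> = ?C (Suc k)"
      using diff symD by (simp add: psd_def del: covD.simps covC.simps)
    finally show ?case using diff symD by (simp add: loewner_le_def del: covD.simps covC.simps)
  qed
qed

section \<open>Feasibility for the deterministic problem\<close>

text \<open>The concave square root lies below its tangent at \<open>l\<close>, which is the linearization that the convex
problem uses in place of the standard deviation; equivalently, this is the AM-GM inequality.\<close>
lemma sqrt_le_tangent:
  assumes "0 < l" "0 \<le> a"
  shows "sqrt a \<le> sqrt l / 2 + 1 / (2 * sqrt l) * a"
proof -
  have "0 \<le> (sqrt a - sqrt l)\<^sup>2" by simp
  then have "2 * sqrt l * sqrt a \<le> l + a"
    using assms by (simp add: power2_diff algebra_simps)
  with assms show ?thesis by (simp add: field_simps)
qed

lemma tightened_constraint_transfer: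
  assumes "0 < l" "0 \<le> a" "a \<le> b" "0 \<le> r"
    and "(sqrt l / 2 + 1 / (2 * sqrt l) * b) * r + m - h \<le> (0::real)"
  shows "m + sqrt a * r - h \<le> 0"
proof -
  have "sqrt a \<le> sqrt b" using assms by simp
  also have "\<dots> \<le> sqrt l / 2 + 1 / (2 * sqrt l) * b"
    using assms by (intro sqrt_le_tangent) auto
  finally have "sqrt a * r \<le> (sqrt l / 2 + 1 / (2 * sqrt l) * b) * r"
    using assms(4) by (rule mult_right_mono)
  with assms(5) show ?thesis by simp
qed

text \<open>Each individual risk level must be below one for the Cantelli factor \<open>(1 - p) / p\<close> to be positive;
the bound comes from the total risk budget.\<close>
lemma risk_in_unit_interval:
  assumes "\<And>i. i \<in> {1..n} \<Longrightarrow> 0 < p i" "(\<Sum>i=1..n. p i) \<le> r" "r < 1/2" "i \<in> {1..n::nat}"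
  shows "p i < (1::real)"
proof -
  have "p i \<le> (\<Sum>i=1..n. p i)"
    using assms by (intro member_le_sum) (auto intro: less_imp_le)
  with assms show ?thesis by simp
qed

lemma prisk_in_unit_interval:
  assumes "valid_data P"
  shows "i \<in> {1..num_x P} \<Longrightarrow> 0 < prisk_x P i \<and> prisk_x P i < 1"
    and "i \<in> {1..num_u P} \<Longrightarrow> 0 < prisk_u P i \<and> prisk_u P i < 1"
  using assms risk_in_unit_interval[of "num_x P" "prisk_x P" "risk_x P" i]
    risk_in_unit_interval[of "num_u P" "prisk_u P" "risk_u P" i]
  by (auto simp: valid_data_def)

lemma psd_quad_nonneg: "psd A \<Longrightarrow> 0 \<le> quad v A"
  by (simp add: psd_def quad_def)

theorem feasible_C_imp_feasible_D:
  assumes valid: "valid_data P" and feas: "feasible_C P c Sux Su S"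
    and L: "\<And>k. k < horizon P \<Longrightarrow> L k = Sux k ** matrix_inv (covC P Sux Su S k)"
  shows "feasible_D loewner_le P c L"
proof -
  note px = prisk_in_unit_interval(1)[OF valid] and pu = prisk_in_unit_interval(2)[OF valid]
  have I: "psd (\<Sigma>I P)"
    using valid by (simp add: valid_data_def pos_def_imp_psd)
  have bounds: "k < horizon P \<Longrightarrow> loewner_le (congruence (L k) (covC P Sux Su S k)) (Su k)"
    "k \<le> horizon P \<Longrightarrow> loewner_le (covD P c L k) (covC P Sux Su S k)" for k
    using feasible_C_covariance_bounds[OF I feas, where L = L] L by blast+
  show ?thesis
    unfolding feasible_D_def
  proof (intro conjI allI ballI impI)
    fix k i assume k: "k < horizon P" and i: "i \<in> {1..num_x P}"
    show "\<alpha>x P i \<bullet> xbar P c k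
        + sqrt (quad (\<alpha>x P i) (covD P c L k)) * sqrt ((1 - prisk_x P i) / prisk_x P i)
        - \<beta>x P i \<le> 0"
    proof (rule tightened_constraint_transfer)
      show "0 < lin_x P i k" using valid k i by (simp add: valid_data_def)
      show "quad (\<alpha>x P i) (covD P c L k) \<le> quad (\<alpha>x P i) (covC P Sux Su S k)"
        using bounds(2)[of k] k by (intro loewner_le_quad) auto
    qed (use feas k i px[OF i] psd_covD[OF I] in \<open>auto simp: feasible_C_def psd_quad_nonneg\<close>)
  next
    fix k i assume k: "k < horizon P" and i: "i \<in> {1..num_u P}"
    show "\<alpha>u P i \<bullet> c k
        + sqrt (quad (\<alpha>u P i) (covDu P c L k)) * sqrt ((1 - prisk_u P i) / prisk_u P i)
        - \<beta>u P i \<le> 0"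
    proof (rule tightened_constraint_transfer)
      show "0 < lin_u P i k" using valid k i by (simp add: valid_data_def)
      have "loewner_le (covDu P c L k) (Su k)"
        unfolding covDu_def congruence_def[symmetric]
        using bounds(1)[OF k] loewner_le_congruence[OF bounds(2)[of k]] k
        by (auto intro: loewner_le_trans)
      then show "quad (\<alpha>u P i) (covDu P c L k) \<le> quad (\<alpha>u P i) (Su k)"
        by (rule loewner_le_quad)
      show "0 \<le> quad (\<alpha>u P i) (covDu P c L k)"
        unfolding covDu_def congruence_def[symmetric]
        by (intro psd_quad_nonneg psd_congruence psd_covD[OF I])
    qed (use feas k i pu[OF i] in \<open>auto simp: feasible_C_def\<close>)
  next
    show "xbar P c (horizon P) = \<mu>F P" using feas by (simp add: feasible_C_def)
    show "loewner_le (covD P c L (horizon P)) (\<Sigma>F P)"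
      using feas bounds(2)[of "horizon P"] by (auto simp: feasible_C_def intro: loewner_le_trans)
  qed
qed

section \<open>Square-integrable random vectors and chance constraints\<close>

text \<open>The one-sided sharpening of Chebyshev's inequality: apply Markov's inequality to
\<open>(Y + s)\<^sup>2\<close> and optimize over the shift \<open>s \<ge> 0\<close>.\<close>
lemma (in prob_space) cantelli_inequality:
  assumes Y: "integrable M Y" "integrable M (\<lambda>w. (Y w)\<^sup>2)" "expectation Y = 0" and t: "0 < t"
  shows "prob {w \<in> space M. t < Y w}
    \<le> expectation (\<lambda>w. (Y w)\<^sup>2) / (expectation (\<lambda>w. (Y w)\<^sup>2) + t\<^sup>2)"
proof -
  define v where "v = expectation (\<lambda>w. (Y w)\<^sup>2)"
  \<comment> \<open>The shift that minimizes the Markov bound \<open>(v + s\<^sup>2) / (t + s)\<^sup>2\<close>.\<close>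
  define s where "s = v / t"
  have [measurable]: "random_variable borel Y" using Y by simp
  have v: "0 \<le> v" by (simp add: v_def)
  then have s: "0 \<le> s" using t by (simp add: s_def)
  have sq: "(Y w + s)\<^sup>2 = (Y w)\<^sup>2 + 2 * s * Y w + s\<^sup>2" for w
    by (simp add: power2_sum algebra_simps)
  have int: "integrable M (\<lambda>w. (Y w + s)\<^sup>2)"
    unfolding sq using Y by (intro Bochner_Integration.integrable_add) auto
  have E: "expectation (\<lambda>w. (Y w + s)\<^sup>2) = v + s\<^sup>2"
    unfolding sq using Y by (simp add: v_def prob_space)
  have "prob {w \<in> space M. t < Y w} \<le> prob {w \<in> space M. (t + s)\<^sup>2 \<le> (Y w + s)\<^sup>2}"
    using t s by (intro finite_measure_mono) (auto intro!: power_mono)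
  also have "\<dots> \<le> (v + s\<^sup>2) / (t + s)\<^sup>2"
    unfolding E[symmetric] using int t s
    by (intro integral_Markov_inequality_measure[where A = "space M"]) auto
  also have "\<dots> = v / (v + t\<^sup>2)"
  proof -
    have "v + s\<^sup>2 = v * (t\<^sup>2 + v) / t\<^sup>2" "(t + s)\<^sup>2 = (t\<^sup>2 + v)\<^sup>2 / t\<^sup>2"
      using t by (simp_all add: s_def field_simps power2_eq_square)
    moreover have "0 < t\<^sup>2 + v" "0 < t\<^sup>2" using v t by (simp_all add: add_pos_nonneg)
    moreover have "v * d / c / (d\<^sup>2 / c) = v / d" if "0 < d" "0 < c" for c d
      using that by (simp add: power2_eq_square)
    ultimately show ?thesis by (simp only: add.commute[of v "t\<^sup>2"])
  qed
  finally show ?thesis by (simp add: v_def)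
qed

lemma norm_outer: "norm (outer v) = (norm v)\<^sup>2"
proof -
  have "norm (outer v $ i) = \<bar>v $ i\<bar> * norm v" for i
  proof -
    have "outer v $ i = v $ i *\<^sub>R v" by (simp add: outer_def vec_eq_iff)
    then show ?thesis by simp
  qed
  then have "norm (outer v) = L2_set (\<lambda>i. \<bar>v $ i\<bar> * norm v) UNIV"
    by (simp add: norm_vec_def)
  also have "\<dots> = L2_set (\<lambda>i. norm (v $ i)) UNIV * norm v"
    by (simp add: L2_set_left_distrib)
  finally show ?thesis by (simp add: norm_vec_def power2_eq_square)
qed

lemma continuous_on_outer: "continuous_on UNIV outer"
  unfolding outer_def by (intro continuous_intros)

lemma continuous_on_matrix_vector_mult: "continuous_on UNIV (\<lambda>v. A *v (v::real^'n))"
  by (intro linear_continuous_on matrix_vector_mul_bounded_linear)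

lemma measurable_outer[measurable]: "outer \<in> borel_measurable borel"
  by (rule borel_measurable_continuous_onI[OF continuous_on_outer])

lemma measurable_matrix_vector_mult[measurable]:
  "(\<lambda>v. A *v (v::real^'n)) \<in> borel_measurable borel"
  by (rule borel_measurable_continuous_onI[OF continuous_on_matrix_vector_mult])

lemma integrable_mult_of_squares:
  fixes f g :: "'w \<Rightarrow> real"
  assumes [measurable]: "f \<in> borel_measurable M" "g \<in> borel_measurable M"
    and "integrable M (\<lambda>w. (f w)\<^sup>2)" "integrable M (\<lambda>w. (g w)\<^sup>2)"
  shows "integrable M (\<lambda>w. f w * g w)"
proof (rule Bochner_Integration.integrable_bound)
  show "integrable M (\<lambda>w. (f w)\<^sup>2 + (g w)\<^sup>2)" using assms by simp
  have "\<bar>a * b\<bar> \<le> a\<^sup>2 + b\<^sup>2" for a b :: real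
  proof -
    have "2 * (\<bar>a\<bar> * \<bar>b\<bar>) \<le> a\<^sup>2 + b\<^sup>2"
      using sum_squares_bound[of "\<bar>a\<bar>" "\<bar>b\<bar>"] by simp
    moreover have "0 \<le> \<bar>a\<bar> * \<bar>b\<bar>" by simp
    ultimately show ?thesis unfolding abs_mult by linarith
  qed
  then show "AE w in M. norm (f w * g w) \<le> norm ((f w)\<^sup>2 + (g w)\<^sup>2)" by simp
qed measurable

lemma square_integrable_rv_measurable:
  "square_integrable_rv M X \<Longrightarrow> X \<in> borel_measurable M"
  by (simp add: square_integrable_rv_def)

lemma square_integrable_rv_matrix_mult:
  assumes X: "square_integrable_rv M X"
  shows "square_integrable_rv M (\<lambda>w. A *v X w)"
proof -
  have [measurable]: "X \<in> borel_measurable M" using X by (simp add: square_integrable_rv_def)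
  obtain K where K: "\<And>x. norm (A *v x) \<le> norm x * K"
    using bounded_linear.bounded[OF matrix_vector_mul_bounded_linear] by metis
  have "integrable M (\<lambda>w. (norm (A *v X w))\<^sup>2)"
  proof (rule Bochner_Integration.integrable_bound)
    show "integrable M (\<lambda>w. K\<^sup>2 * (norm (X w))\<^sup>2)"
      using X by (simp add: square_integrable_rv_def)
    have "(norm (A *v x))\<^sup>2 \<le> K\<^sup>2 * (norm x)\<^sup>2" for x
      using power_mono[OF K[of x], of 2] by (simp add: power_mult_distrib mult.commute)
    then show "AE w in M. norm ((norm (A *v X w))\<^sup>2) \<le> norm (K\<^sup>2 * (norm (X w))\<^sup>2)"
      by simp
  qed measurable
  then show ?thesis by (simp add: square_integrable_rv_def)
qed

lemma square_integrable_rv_add: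
  fixes X Y :: "'w \<Rightarrow> real^'n"
  assumes X: "square_integrable_rv M X" and Y: "square_integrable_rv M Y"
  shows "square_integrable_rv M (\<lambda>w. X w + Y w)"
proof -
  have [measurable]: "X \<in> borel_measurable M" "Y \<in> borel_measurable M"
    using X Y by (auto simp: square_integrable_rv_def)
  have "integrable M (\<lambda>w. (norm (X w + Y w))\<^sup>2)"
  proof (rule Bochner_Integration.integrable_bound)
    show "integrable M (\<lambda>w. 2 * (norm (X w))\<^sup>2 + 2 * (norm (Y w))\<^sup>2)"
      using X Y by (simp add: square_integrable_rv_def)
    have "(norm (x + y))\<^sup>2 \<le> 2 * (norm x)\<^sup>2 + 2 * (norm y)\<^sup>2" for x y :: "real^'n"
      using power_mono[OF norm_triangle_ineq[of x y], of 2]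
        sum_squares_bound[of "norm x" "norm y"] by (simp add: power2_sum)
    then show "AE w in M. norm ((norm (X w + Y w))\<^sup>2)
        \<le> norm (2 * (norm (X w))\<^sup>2 + 2 * (norm (Y w))\<^sup>2)"
      by simp
  qed measurable
  then show ?thesis by (simp add: square_integrable_rv_def)
qed

lemma (in prob_space) square_integrable_rv_const: "square_integrable_rv M (\<lambda>_. a)"
  by (simp add: square_integrable_rv_def)

lemma (in prob_space) square_integrable_rv_diff_const:
  "square_integrable_rv M X \<Longrightarrow> square_integrable_rv M (\<lambda>w. X w - a)"
  using square_integrable_rv_add[OF _ square_integrable_rv_const[of "- a"]] by simp

lemma square_integrable_rv_inner:
  assumes X: "square_integrable_rv M X"
  shows "integrable M (\<lambda>w. (v \<bullet> X w)\<^sup>2)"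
proof (rule Bochner_Integration.integrable_bound)
  have [measurable]: "X \<in> borel_measurable M" using X by (simp add: square_integrable_rv_def)
  show "(\<lambda>w. (v \<bullet> X w)\<^sup>2) \<in> borel_measurable M" by measurable
  show "integrable M (\<lambda>w. (norm v)\<^sup>2 * (norm (X w))\<^sup>2)"
    using X by (simp add: square_integrable_rv_def)
  have "(v \<bullet> x)\<^sup>2 \<le> (norm v)\<^sup>2 * (norm x)\<^sup>2" for x
    using Cauchy_Schwarz_ineq[of v x] by (simp add: power2_norm_eq_inner)
  then show "AE w in M. norm ((v \<bullet> X w)\<^sup>2) \<le> norm ((norm v)\<^sup>2 * (norm (X w))\<^sup>2)"
    by simp
qed

lemma square_integrable_rv_product:
  assumes "square_integrable_rv M X" "square_integrable_rv M Y"
  shows "integrable M (\<lambda>w. (u \<bullet> X w) * (v \<bullet> Y w))"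
  using assms
  by (intro integrable_mult_of_squares square_integrable_rv_inner borel_measurable_inner
      borel_measurable_const square_integrable_rv_measurable)

lemma square_integrable_rv_inner_product:
  assumes "square_integrable_rv M X" "square_integrable_rv M (Y :: _ \<Rightarrow> real^'n)"
  shows "integrable M (\<lambda>w. X w \<bullet> Y w)"
proof -
  have "X w \<bullet> Y w = (\<Sum>i\<in>UNIV. (axis i 1 \<bullet> X w) * (axis i 1 \<bullet> Y w))" for w
    by (simp add: inner_axis' inner_vec_def[of "X w"])
  then show ?thesis
    using square_integrable_rv_product[OF assms] by simp
qed

context prob_space
begin

lemma square_integrable_rv_integrable:
  fixes X :: "'a \<Rightarrow> real^'n"
  assumes X: "square_integrable_rv M X"
  shows "integrable M X"
proof -
  have [measurable]: "X \<in> borel_measurable M" using X by (simp add: square_integrable_rv_def)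
  have "norm x \<le> 1 + (norm x)\<^sup>2" for x :: "real^'n"
    using sum_squares_bound[of "norm x" 1] norm_ge_zero[of x]
    by (simp only: power_one mult_1_right)
  then have le: "AE w in M. norm (X w) \<le> norm (1 + (norm (X w))\<^sup>2)" by simp
  have "integrable M (\<lambda>w. 1 + (norm (X w))\<^sup>2)"
    using X by (simp add: square_integrable_rv_def)
  then show ?thesis
    by (rule Bochner_Integration.integrable_bound[OF _ _ le]) fact
qed

lemma expectation_inner_mean:
  "square_integrable_rv M X \<Longrightarrow> expectation (\<lambda>w. v \<bullet> X w) = v \<bullet> mean M X"
  by (simp add: mean_def square_integrable_rv_integrable)

lemma expectation_inner_centered:
  assumes "square_integrable_rv M X"
  shows "expectation (\<lambda>w. v \<bullet> (X w - mean M X)) = 0"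
  using expectation_inner_mean[OF assms, of v] square_integrable_rv_integrable[OF assms]
  by (simp add: inner_diff_right prob_space)

text \<open>A covariance matrix is determined by its bilinear form, so all later covariance computations
reduce to expectations of products of two real random variables.\<close>
lemma inner_covariance:
  assumes X: "square_integrable_rv M X"
  shows "u \<bullet> (covariance M X *v v)
    = expectation (\<lambda>w. (u \<bullet> (X w - mean M X)) * (v \<bullet> (X w - mean M X)))"
proof -
  let ?Y = "\<lambda>w. X w - mean M X"
  have Y: "square_integrable_rv M ?Y" by (rule square_integrable_rv_diff_const[OF X])
  then have [measurable]: "?Y \<in> borel_measurable M" by (rule square_integrable_rv_measurable)
  have "integrable M (\<lambda>w. norm (outer (?Y w)))"
    using Y by (simp add: norm_outer square_integrable_rv_def)
  then have int: "integrable M (\<lambda>w. outer (?Y w))"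
    by (subst integrable_norm_iff[symmetric]) measurable
  have lin: "bounded_linear (\<lambda>A. u \<bullet> (A *v v))"
    by (auto simp: linear_conv_bounded_linear[symmetric] linear_iff inner_right_distrib
        matrix_vector_mult_add_rdistrib scaleR_matrix_vector_assoc[symmetric])
  have "u \<bullet> (covariance M X *v v) = expectation (\<lambda>w. u \<bullet> (outer (?Y w) *v v))"
    unfolding covariance_def by (rule integral_bounded_linear[OF lin int, symmetric])
  then show ?thesis by (simp add: outer_mult_vector inner_commute mult.commute)
qed

text \<open>The deterministic constraint is calibrated so that Cantelli's inequality, applied to the centred
variable \<open>a \<bullet> X\<close> at the distance from the mean to the boundary, gives exactly the level \<open>p\<close>, whatever
the law of \<open>X\<close>. Distance zero forces the variance to vanish and is treated separately.\<close>
lemma chance_constraint_halfspace: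
  assumes X: "square_integrable_rv M X" and p: "0 < p" "p < 1"
    and c: "a \<bullet> mean M X + sqrt (quad a (covariance M X)) * sqrt ((1 - p) / p) - b \<le> 0"
  shows "prob {w \<in> space M. b < a \<bullet> X w} \<le> p"
proof -
  define Y where "Y w = a \<bullet> (X w - mean M X)" for w
  define v where "v = expectation (\<lambda>w. (Y w)\<^sup>2)"
  define t where "t = b - a \<bullet> mean M X"
  have v: "quad a (covariance M X) = v" "0 \<le> v"
    by (simp_all add: v_def Y_def quad_def inner_covariance[OF X] power2_eq_square)
  have Y2: "integrable M (\<lambda>w. (Y w)\<^sup>2)"
    unfolding Y_def by (intro square_integrable_rv_inner square_integrable_rv_diff_const X)
  have Y1: "integrable M Y"
    unfolding Y_def using square_integrable_rv_integrable[OF X] by simp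
  have Y0: "expectation Y = 0"
    unfolding Y_def by (rule expectation_inner_centered[OF X])
  have ev: "{w \<in> space M. b < a \<bullet> X w} = {w \<in> space M. t < Y w}"
    by (auto simp: t_def Y_def inner_diff_right)
  have "sqrt (v * ((1 - p) / p)) \<le> t"
    using c unfolding v real_sqrt_mult t_def by linarith
  moreover have "0 \<le> v * ((1 - p) / p)" using v p by simp
  ultimately have t: "0 \<le> t" "v * ((1 - p) / p) \<le> t\<^sup>2"
    by (meson order_trans real_sqrt_ge_zero, metis sqrt_le_D)
  show ?thesis
  proof (cases "t = 0")
    case True
    then have "v = 0" using t v p
      by (simp add: mult_le_0_iff zero_le_mult_iff divide_le_0_iff)
    then have "AE w in M. Y w = 0"
      using Y2 by (simp add: v_def integral_nonneg_eq_0_iff_AE)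
    then have "AE w in M. w \<notin> {w \<in> space M. t < Y w}"
      using True by auto
    then have "prob {w \<in> space M. t < Y w} = 0"
      using Y1 by (subst prob_eq_0) auto
    then show ?thesis using p ev by simp
  next
    case False
    then have "0 < t" using t by simp
    then have pos: "0 < v + t\<^sup>2" using v by (simp add: add_nonneg_pos)
    have "v * (1 - p) \<le> t\<^sup>2 * p" using t p by (simp add: field_simps)
    then have "v / (v + t\<^sup>2) \<le> p" using pos by (simp add: field_simps)
    then show ?thesis
      using cantelli_inequality[OF Y1 Y2 Y0 \<open>0 < t\<close>] by (simp add: ev v_def)
  qed
qed

text \<open>A union bound over the faces turns the individual risk levels into the joint one.\<close>
lemma chance_constraint_polyhedron:
  assumes [measurable]: "random_variable borel X"
    and h: "\<And>i. i \<in> {1..n} \<Longrightarrow> prob {w \<in> space M. b i < a i \<bullet> X w} \<le> p i"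
    and p: "(\<Sum>i=1..n. p i) \<le> r"
  shows "1 - r \<le> prob {w \<in> space M. X w \<in> polyhedron_of n a b}"
proof -
  let ?G = "{w \<in> space M. X w \<in> polyhedron_of n a b}"
  let ?B = "\<lambda>i. {w \<in> space M. b i < a i \<bullet> X w}"
  have G: "?G = space M - (\<Union>i\<in>{1..n}. ?B i)"
    by (auto simp: polyhedron_of_def not_less)
  have "prob (\<Union>i\<in>{1..n}. ?B i) \<le> (\<Sum>i=1..n. prob (?B i))"
    by (intro finite_measure_subadditive_finite) auto
  also have "\<dots> \<le> (\<Sum>i=1..n. p i)" by (intro sum_mono h)
  finally show ?thesis
    using p unfolding G by (subst prob_compl) auto
qed

end

section \<open>Independence of past and present noise\<close>

context prob_space
begin

lemma indep_set_mono:
  assumes "indep_set A B" "A' \<subseteq> A" "B' \<subseteq> B"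
  shows "indep_set A' B'"
  using assms indep_setD[OF assms(1)] indep_setD_ev1[OF assms(1)] indep_setD_ev2[OF assms(1)]
  by (intro indep_setI) blast+

text \<open>Here \<open>X\<close> is the initial state, \<open>A\<close> indexes the past noises and \<open>B\<close> the present ones. The events
\<open>a \<inter> b\<close>, with \<open>a\<close> about \<open>X\<close> and \<open>b\<close> about the past noises, form a \<open>\<pi>\<close>-system, so it suffices to
test independence on them. There it follows by splitting off \<open>X\<close>, which is independent of all
noises jointly, then separating \<open>A\<close> from \<open>B\<close>, and then rejoining \<open>X\<close> with \<open>A\<close>.\<close>
lemma indep_set_past_present:
  assumes Q: "indep_vars N Q I"
    and X: "random_variable NX X"
    and XQ: "indep_set (sets (vimage_algebra (space M) X NX))
        (sets (vimage_algebra (space M) (\<lambda>w. \<lambda>i\<in>I. Q i w) (PiM I N)))"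
    and AB: "A \<inter> B = {}" "A \<subseteq> I" "B \<subseteq> I"
  shows "indep_set
      (sigma_sets (space M) {a \<inter> b | a b. a \<in> sets (vimage_algebra (space M) X NX) \<and>
         b \<in> sets (vimage_algebra (space M) (\<lambda>w. \<lambda>i\<in>A. Q i w) (PiM A N))})
      (sets (vimage_algebra (space M) (\<lambda>w. \<lambda>i\<in>B. Q i w) (PiM B N)))"
proof -
  define \<X> where "\<X> = sets (vimage_algebra (space M) X NX)"
  define \<Q> where "\<Q> J = sets (vimage_algebra (space M) (\<lambda>w. \<lambda>i\<in>J. Q i w) (PiM J N))" for J
  define E where "E = {a \<inter> b | a b. a \<in> \<X> \<and> b \<in> \<Q> A}"
  have Qm: "random_variable (N i) (Q i)" if "i \<in> I" for i
    using Q that by (simp add: indep_vars_def)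
  have \<Q>_mono: "\<Q> J \<subseteq> \<Q> I" if J: "J \<subseteq> I" for J
  proof -
    have in_PiM: "(\<lambda>w. \<lambda>i\<in>I. Q i w) \<in> space M \<rightarrow> space (PiM I N)"
      by (auto simp: space_PiM intro: measurable_space[OF Qm])
    have "(\<lambda>w. \<lambda>i\<in>J. Q i w) = (\<lambda>f. restrict f J) \<circ> (\<lambda>w. \<lambda>i\<in>I. Q i w)"
      using J by (auto simp: fun_eq_iff)
    also have "\<dots> \<in> measurable (vimage_algebra (space M) (\<lambda>w. \<lambda>i\<in>I. Q i w) (PiM I N)) (PiM J N)"
      using J by (intro measurable_comp[OF measurable_vimage_algebra1[OF in_PiM]]
          measurable_restrict_subset)
    finally show ?thesis
      unfolding \<Q>_def by (intro sets_image_in_sets) auto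
  qed
  have \<Q>AB: "indep_set (\<Q> A) (\<Q> B)"
    using indep_var_restrict[OF Q AB] unfolding indep_var_eq \<Q>_def sets_vimage_algebra by simp
  note ev = indep_setD_ev1[OF XQ, folded \<X>_def] indep_setD_ev1[OF \<Q>AB] indep_setD_ev2[OF \<Q>AB]
  have indep: "indep_set E (\<Q> B)"
  proof (rule indep_setI)
    show "E \<subseteq> events" using ev by (auto simp: E_def)
    show "\<Q> B \<subseteq> events" by (rule ev)
    fix e d assume "e \<in> E" and d: "d \<in> \<Q> B"
    then obtain a b where e: "e = a \<inter> b" and a: "a \<in> \<X>" and b: "b \<in> \<Q> A"
      by (auto simp: E_def)
    note XQD = indep_setD[OF XQ, folded \<X>_def \<Q>_def, OF a]
    have "b \<inter> d \<in> \<Q> I"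
      using b d \<Q>_mono[OF AB(2)] \<Q>_mono[OF AB(3)] unfolding \<Q>_def by blast
    then have "prob (a \<inter> (b \<inter> d)) = prob a * prob (b \<inter> d)" by (rule XQD)
    also have "\<dots> = prob a * prob b * prob d"
      using indep_setD[OF \<Q>AB b d] by simp
    also have "prob a * prob b = prob (a \<inter> b)"
      using b \<Q>_mono[OF AB(2)] by (intro XQD[symmetric]) blast
    finally show "prob (e \<inter> d) = prob e * prob d" by (simp add: e Int_assoc)
  qed
  have "Int_stable E"
  proof (rule Int_stableI)
    fix e e' assume "e \<in> E" "e' \<in> E"
    then obtain a b a' b' where "e = a \<inter> b" "e' = a' \<inter> b'" "a \<in> \<X>" "a' \<in> \<X>" "b \<in> \<Q> A" "b' \<in> \<Q> A"
      by (auto simp: E_def)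
    moreover from this have "a \<inter> a' \<in> \<X>" "b \<inter> b' \<in> \<Q> A" by (auto simp: \<X>_def \<Q>_def)
    moreover have "(a \<inter> b) \<inter> (a' \<inter> b') = (a \<inter> a') \<inter> (b \<inter> b')" by auto
    ultimately show "e \<inter> e' \<in> E"
      unfolding E_def mem_Collect_eq by (intro exI[of _ "a \<inter> a'"] exI[of _ "b \<inter> b'"]) simp
  qed
  moreover have "Int_stable (\<Q> B)" by (auto simp: \<Q>_def intro: Int_stableI)
  ultimately have "indep_set (sigma_sets (space M) E) (sigma_sets (space M) (\<Q> B))"
    using indep by (intro indep_set_sigma_sets)
  then show ?thesis
    unfolding E_def \<X>_def \<Q>_def
    using sets.sigma_sets_eq[of "vimage_algebra (space M) (\<lambda>w. \<lambda>i\<in>B. Q i w) (PiM B N)"]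
    by simp
qed

lemma indep_set_expectation_mult:
  fixes e f :: "'a \<Rightarrow> real"
  assumes FG: "indep_set (sets F) (sets G)" and sp: "space F = space M" "space G = space M"
    and f: "f \<in> borel_measurable F" "integrable M f"
    and e: "e \<in> borel_measurable G" "integrable M e"
  shows "integrable M (\<lambda>w. e w * f w)"
    and "expectation (\<lambda>w. e w * f w) = expectation e * expectation f"
proof -
  have sub: "sigma_sets (space M) {h -` A \<inter> space M |A. A \<in> sets borel} \<subseteq> sets H"
    if "h \<in> borel_measurable H" "space H = space M" for h :: "'a \<Rightarrow> real" and H
  proof -
    have "h -` A \<inter> space M \<in> sets H" if "A \<in> sets borel" for A
      using measurable_sets[OF \<open>h \<in> borel_measurable H\<close> that] \<open>space H = space M\<close> by simp
    then have "{h -` A \<inter> space M |A. A \<in> sets borel} \<subseteq> sets H" by auto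
    then show ?thesis
      unfolding that(2)[symmetric] by (rule sets.sigma_sets_subset)
  qed
  have GF: "indep_set (sets G) (sets F)"
  proof (rule indep_setI)
    show "sets G \<subseteq> events" "sets F \<subseteq> events"
      using indep_setD_ev1[OF FG] indep_setD_ev2[OF FG] by auto
    show "prob (a \<inter> b) = prob a * prob b" if "a \<in> sets G" "b \<in> sets F" for a b
      using indep_setD[OF FG that(2) that(1)] by (simp add: Int_commute mult.commute)
  qed
  have "indep_set (sigma_sets (space M) {e -` A \<inter> space M |A. A \<in> sets borel})
      (sigma_sets (space M) {f -` A \<inter> space M |A. A \<in> sets borel})"
    by (rule indep_set_mono[OF GF sub[OF e(1) sp(2)] sub[OF f(1) sp(1)]])
  then have ind: "indep_var borel e borel f"
    using f(2) e(2) by (simp add: indep_var_eq)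
  show "integrable M (\<lambda>w. e w * f w)"
    and "expectation (\<lambda>w. e w * f w) = expectation e * expectation f"
    by (rule indep_var_integrable[OF ind e(2) f(2)] indep_var_lebesgue_integral[OF ind e(2) f(2)])+
qed

end

locale steering_randomness = prob_space M for M :: "'w measure" +
  fixes P :: "('x::finite, 'u::finite) steering_data"
    and x0 :: "'w \<Rightarrow> real^'x" and q :: "nat \<Rightarrow> nat \<Rightarrow> 'w \<Rightarrow> real"
  assumes valid: "valid_randomness P M x0 q"
begin

abbreviation info :: "nat \<Rightarrow> 'w measure" where
  "info k \<equiv> information P M x0 q k"

text \<open>The sigma-algebra generated jointly by all noises acting at time \<open>k\<close>. Joint rather than individual
independence from the past is what makes products of two noises factor off.\<close>
definition present :: "nat \<Rightarrow> 'w measure" where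
  "present k = vimage_algebra (space M) (\<lambda>w. \<lambda>i\<in>{1..noise_dim P} \<times> {k}. (\<lambda>(j, l). q j l) i w)
     (PiM ({1..noise_dim P} \<times> {k}) (\<lambda>_. borel))"

lemma x0_square_integrable: "square_integrable_rv M x0"
  and mean_x0: "mean M x0 = \<mu>I P"
  and covariance_x0: "covariance M x0 = \<Sigma>I P"
  using valid by (auto simp: valid_randomness_def initial_state_law_def)

lemma indep_noise: "indep_vars (\<lambda>_. borel) (\<lambda>(j, l). q j l) (noise_index P)"
  using valid by (simp add: valid_randomness_def)

lemma noise_distributed:
  "j \<in> {1..noise_dim P} \<Longrightarrow> distributed M lborel (q j k) std_normal_density"
  using valid by (simp add: valid_randomness_def)

lemma noise_measurable: "j \<in> {1..noise_dim P} \<Longrightarrow> random_variable borel (q j k)"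
  using distributed_measurable[OF noise_distributed] by simp

lemma space_info[simp]: "space (info k) = space M"
  by (auto simp: information_def intro!: space_measure_of)

lemma space_present[simp]: "space (present k) = space M"
  by (simp add: present_def)

lemma sets_info:
  "sets (info k) = sigma_sets (space M)
     ({x0 -` S \<inter> space M | S. S \<in> sets borel} \<union>
      {q j l -` S \<inter> space M | j l S. j \<in> {1..noise_dim P} \<and> l < k \<and> S \<in> sets borel})"
  unfolding information_def by (rule sets_measure_of) auto

lemma x0_measurable_info: "x0 \<in> borel_measurable (info k)"
  by (rule measurableI) (auto simp: sets_info intro!: sigma_sets.Basic)

lemma noise_measurable_info:
  "j \<in> {1..noise_dim P} \<Longrightarrow> l < k \<Longrightarrow> q j l \<in> borel_measurable (info k)"
  by (rule measurableI) (auto simp: sets_info intro!: sigma_sets.Basic)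

lemma noise_measurable_present:
  assumes "j \<in> {1..noise_dim P}"
  shows "q j k \<in> borel_measurable (present k)"
proof -
  let ?B = "{1..noise_dim P} \<times> {k}"
  let ?f = "\<lambda>w. \<lambda>i\<in>?B. (\<lambda>(j, l). q j l) i w"
  have "?f \<in> measurable (present k) (PiM ?B (\<lambda>_. borel))"
    unfolding present_def by (intro measurable_vimage_algebra1) (auto simp: space_PiM)
  from measurable_compose[OF this measurable_component_singleton[of "(j, k)"]] assms
  show ?thesis by simp
qed

text \<open>This is where causality enters: what is known at time \<open>k\<close> is independent of the noises acting at
time \<open>k\<close>. The generators of \<open>info k\<close> are among the \<open>\<pi>\<close>-system events of
\<open>indep_set_past_present\<close>, with the whole space as the other factor.\<close>
lemma indep_info_present: "indep_set (sets (info k)) (sets (present k))"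
proof -
  let ?Q = "\<lambda>(j, l). q j l" and ?A = "{1..noise_dim P} \<times> {..<k}"
  let ?X = "vimage_algebra (space M) x0 borel"
  let ?V = "\<lambda>J. vimage_algebra (space M) (\<lambda>w. \<lambda>i\<in>J. ?Q i w) (PiM J (\<lambda>_. borel))"
  have restr: "(\<lambda>w. \<lambda>(j, l)\<in>noise_index P. q j l w) = (\<lambda>w. \<lambda>i\<in>noise_index P. ?Q i w)"
    by (auto simp: fun_eq_iff)
  have "indep_set (sets ?X) (sets (?V (noise_index P)))"
    using valid unfolding valid_randomness_def restr by blast
  then have ind: "indep_set (sigma_sets (space M) {a \<inter> b | a b. a \<in> sets ?X \<and> b \<in> sets (?V ?A)})
      (sets (present k))"
    unfolding present_def
    by (intro indep_set_past_present[OF indep_noise])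
      (auto simp: noise_index_def square_integrable_rv_measurable x0_square_integrable)
  define E where "E = {a \<inter> b | a b. a \<in> sets ?X \<and> b \<in> sets (?V ?A)}"
  have "{x0 -` S \<inter> space M | S. S \<in> sets borel} \<subseteq> E"
  proof
    fix a assume "a \<in> {x0 -` S \<inter> space M | S. S \<in> sets borel}"
    then have "a \<in> sets ?X" "a = a \<inter> space M" by (auto intro: in_vimage_algebra)
    moreover have "space M \<in> sets (?V ?A)"
      using sets.top[of "?V ?A"] by simp
    ultimately show "a \<in> E" unfolding E_def by blast
  qed
  moreover have "{q j l -` S \<inter> space M | j l S. j \<in> {1..noise_dim P} \<and> l < k \<and> S \<in> sets borel} \<subseteq> E"
  proof
    fix b assume "b \<in> {q j l -` S \<inter> space M | j l S. j \<in> {1..noise_dim P} \<and> l < k \<and> S \<in> sets borel}"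
    then obtain j l S where b: "b = q j l -` S \<inter> space M" and jl: "(j, l) \<in> ?A"
      and S: "S \<in> sets borel"
      by auto
    have "(\<lambda>w. \<lambda>i\<in>?A. ?Q i w) \<in> measurable (?V ?A) (PiM ?A (\<lambda>_. borel))"
      by (intro measurable_vimage_algebra1) (auto simp: space_PiM)
    from measurable_compose[OF this measurable_component_singleton[OF jl]] jl
    have "q j l \<in> borel_measurable (?V ?A)" by simp
    from measurable_sets[OF this S] have "b \<in> sets (?V ?A)" by (simp add: b)
    moreover have "b = space M \<inter> b" by (auto simp: b)
    moreover have "space M \<in> sets ?X" using sets.top[of ?X] by simp
    ultimately show "b \<in> E" unfolding E_def by blast
  qed
  ultimately have "sets (info k) \<subseteq> sigma_sets (space M) E"
    unfolding sets_info by (intro sigma_sets_mono' Un_least)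
  then show ?thesis
    by (rule indep_set_mono[OF ind[folded E_def]]) simp
qed

lemma subalgebra_info_Suc: "subalgebra (info (Suc k)) (info k)"
  unfolding subalgebra_def sets_info space_info
  by (intro conjI refl sigma_sets_mono' Un_mono order_refl) (auto intro: less_SucI)

text \<open>Adjoining the constant one as the member with index \<open>0\<close> lets the noise-free part of the dynamics
be treated as one more noise channel. The enlarged family is still orthonormal, although its first
member does not have mean zero.\<close>
definition white :: "nat \<Rightarrow> nat \<Rightarrow> 'w \<Rightarrow> real" where
  "white k i w = (if i = 0 then 1 else q i k w)"

lemma white_measurable_present:
  "i \<in> {0..noise_dim P} \<Longrightarrow> white k i \<in> borel_measurable (present k)"
  unfolding white_def by (cases "i = 0") (auto intro!: noise_measurable_present)

lemma noise_square:
  assumes "j \<in> {1..noise_dim P}"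
  shows "integrable M (\<lambda>w. (q j k w)\<^sup>2)" "expectation (\<lambda>w. (q j k w)\<^sup>2) = 1"
    "integrable M (q j k)" "expectation (q j k) = 0"
proof -
  note D = noise_distributed[OF assms, of k]
  show "integrable M (\<lambda>w. (q j k w)\<^sup>2)"
    using distributed_integrable[OF D, of "\<lambda>x. x\<^sup>2"] integrable_std_normal_moment[of 2] by simp
  show "integrable M (q j k)"
    using distributed_integrable[OF D, of "\<lambda>x. x"] integrable_std_normal_moment[of 1] by simp
  show E: "expectation (q j k) = 0" by (rule standard_normal_distributed_expectation[OF D])
  show "expectation (\<lambda>w. (q j k w)\<^sup>2) = 1"
    using standard_normal_distributed_variance[OF D] by (simp add: E)
qed

lemma white_orthonormal:
  assumes "i \<in> {0..noise_dim P}" "j \<in> {0..noise_dim P}"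
  shows "integrable M (\<lambda>w. white k i w * white k j w)"
    and "expectation (\<lambda>w. white k i w * white k j w) = (if i = j then 1 else 0)"
proof -
  have "integrable M (\<lambda>w. white k i w * white k j w) \<and>
      expectation (\<lambda>w. white k i w * white k j w) = (if i = j then 1 else 0)"
  proof (cases "i = 0 \<or> j = 0 \<or> i = j")
    case True
    then show ?thesis
      using assms noise_square[of i k] noise_square[of j k]
      by (cases "i = 0"; cases "j = 0") (simp_all add: white_def prob_space power2_eq_square)
  next
    case False
    let ?Q = "\<lambda>(j, l). q j l" and ?J = "{(i, k), (j, k)}"
    have ij: "i \<in> {1..noise_dim P}" "j \<in> {1..noise_dim P}" using False assms by auto
    have ind: "indep_vars (\<lambda>_. borel) ?Q ?J"
      by (rule indep_vars_subset[OF indep_noise]) (use ij in \<open>auto simp: noise_index_def\<close>)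
    have int: "integrable M (?Q l)" if "l \<in> ?J" for l
      using that ij noise_square(3) by auto
    show ?thesis
      using indep_vars_integrable[OF _ ind int] indep_vars_lebesgue_integral[OF _ ind int]
        False noise_square(4)[OF ij(1), of k]
      by (simp add: white_def)
  qed
  then show "integrable M (\<lambda>w. white k i w * white k j w)"
    and "expectation (\<lambda>w. white k i w * white k j w) = (if i = j then 1 else 0)" by auto
qed

text \<open>Coefficients that are known at time \<open>k\<close> factor out of the expectation, and orthonormality kills
all off-diagonal terms. Every first and second moment of the next state is such an expectation
for a suitable \<open>h\<close>.\<close>
lemma expectation_white_form:
  assumes h: "\<And>i j. i \<in> {0..noise_dim P} \<Longrightarrow> j \<in> {0..noise_dim P} \<Longrightarrow>
      h i j \<in> borel_measurable (info k) \<and> integrable M (h i j)"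
  shows "integrable M (\<lambda>w. \<Sum>i=0..noise_dim P. \<Sum>j=0..noise_dim P. white k i w * white k j w * h i j w)"
    and "expectation (\<lambda>w. \<Sum>i=0..noise_dim P. \<Sum>j=0..noise_dim P. white k i w * white k j w * h i j w)
      = (\<Sum>i=0..noise_dim P. expectation (h i i))"
proof -
  have int: "integrable M (\<lambda>w. white k i w * white k j w * h i j w)"
    and E: "expectation (\<lambda>w. white k i w * white k j w * h i j w)
      = (if i = j then expectation (h i i) else 0)"
    if i: "i \<in> {0..noise_dim P}" and j: "j \<in> {0..noise_dim P}" for i j
    using indep_set_expectation_mult[OF indep_info_present space_info space_present,
        of "h i j" k "\<lambda>w. white k i w * white k j w"]
      h[OF i j] white_orthonormal[OF i j, of k] white_measurable_present[OF i, of k]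
      white_measurable_present[OF j, of k]
    by auto
  show "integrable M (\<lambda>w. \<Sum>i=0..noise_dim P. \<Sum>j=0..noise_dim P. white k i w * white k j w * h i j w)"
    by (intro Bochner_Integration.integrable_sum int)
  have "expectation (\<lambda>w. \<Sum>i=0..noise_dim P. \<Sum>j=0..noise_dim P. white k i w * white k j w * h i j w)
      = (\<Sum>i=0..noise_dim P. \<Sum>j=0..noise_dim P.
          expectation (\<lambda>w. white k i w * white k j w * h i j w))"
    by (subst Bochner_Integration.integral_sum)
      (intro Bochner_Integration.integrable_sum int, assumption+,
        intro sum.cong refl Bochner_Integration.integral_sum int)
  also have "\<dots> = (\<Sum>i=0..noise_dim P. \<Sum>j=0..noise_dim P. if i = j then expectation (h i i) else 0)"
    by (intro sum.cong refl E)
  also have "\<dots> = (\<Sum>i=0..noise_dim P. expectation (h i i))"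
    by (intro sum.cong refl) simp
  finally show "expectation (\<lambda>w. \<Sum>i=0..noise_dim P. \<Sum>j=0..noise_dim P. white k i w * white k j w * h i j w)
      = (\<Sum>i=0..noise_dim P. expectation (h i i))" .
qed

end

lemma vector_eqI_inner: "(\<And>v. v \<bullet> x = v \<bullet> y) \<Longrightarrow> x = (y::real^'n)"
  using vector_eq_ldot by blast

lemma matrix_eqI_inner:
  "(\<And>u v. u \<bullet> (A *v v) = u \<bullet> (B *v v)) \<Longrightarrow> A = (B::real^'n^'m)"
  unfolding matrix_eq by (blast intro: vector_eqI_inner)

lemma (in prob_space) affine_moments:
  fixes X :: "'a \<Rightarrow> real^'n" and K :: "real^'n^'m" and b :: "real^'m"
  assumes X: "square_integrable_rv M X"
  defines "Y \<equiv> \<lambda>w. K *v (X w - mean M X) + b"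
  shows "square_integrable_rv M Y" "mean M Y = b" "covariance M Y = congruence K (covariance M X)"
proof -
  show Y: "square_integrable_rv M Y"
    unfolding Y_def by (intro square_integrable_rv_add square_integrable_rv_matrix_mult
        square_integrable_rv_diff_const square_integrable_rv_const X)
  have KX: "v \<bullet> (K *v x) = (transpose K *v v) \<bullet> x" for v x
    by (rule inner_matrix_mult_right)
  have int: "integrable M (\<lambda>w. (transpose K *v v) \<bullet> (X w - mean M X))" for v
    using square_integrable_rv_integrable[OF X] by (intro integrable_inner_right) simp
  have "v \<bullet> mean M Y = v \<bullet> b" for v
    using expectation_inner_mean[OF Y, of v] int[of v]
      expectation_inner_centered[OF X, of "transpose K *v v"]
    by (simp add: Y_def inner_right_distrib KX prob_space del: transpose_matrix_vector)
  then show m: "mean M Y = b" by (rule vector_eqI_inner)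
  have "u \<bullet> (covariance M Y *v v) = u \<bullet> (congruence K (covariance M X) *v v)" for u v
    unfolding inner_covariance[OF Y] inner_congruence inner_covariance[OF X] m
    by (simp add: Y_def KX del: transpose_matrix_vector)
  then show "covariance M Y = congruence K (covariance M X)"
    by (rule matrix_eqI_inner)
qed

section \<open>Propagation of means and covariances\<close>

lemma matrix_sum_mult_vector: "(\<Sum>j\<in>I. F j) *v x = (\<Sum>j\<in>I. F j *v (x::real^'n))"
  by (induction I rule: infinite_finite_induct) (auto simp: matrix_vector_mult_add_rdistrib)

lemma sum_atLeast0_split: "(\<Sum>i=0..m. f i) = f 0 + (\<Sum>i=1..m::nat. f i)"
  by (simp add: sum.atLeast_Suc_atMost)

text \<open>Writing the state as deviation \<open>y\<close> plus mean \<open>xb\<close> splits the response of each channel into a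
closed-loop linear part and an offset.\<close>
lemma feedback_step_split:
  fixes A :: "real^'x^'x" and B :: "real^'u^'x"
  shows "A *v (y + xb) + B *v (L *v y + c) + d = (A + B ** L) *v y + (A *v xb + B *v c + d)"
  by (simp add: matrix_vector_right_distrib matrix_vector_mult_add_rdistrib
      matrix_vector_mul_assoc algebra_simps)

lemma state_Suc_feedback:
  assumes "u k w = L *v (state P x0 q u k w - xbar P c k) + c k"
  shows "state P x0 q u (Suc k) w
     = (Abar P + Bbar P ** L) *v (state P x0 q u k w - xbar P c k) + xbar P c (Suc k)
       + (\<Sum>j=1..noise_dim P. q j k w *\<^sub>R
           ((Atil P j + Btil P j ** L) *v (state P x0 q u k w - xbar P c k) + noise_gain P c j k))"
proof -
  define y where "y = state P x0 q u k w - xbar P c k"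
  have x: "state P x0 q u k w = y + xbar P c k" by (simp add: y_def)
  have u: "u k w = L *v y + c k" using assms by (simp add: y_def)
  have "state P x0 q u (Suc k) w
     = (Abar P *v (y + xbar P c k) + Bbar P *v (L *v y + c k) + dbar P)
       + (\<Sum>j=1..noise_dim P. q j k w *\<^sub>R
           (Atil P j *v (y + xbar P c k) + Btil P j *v (L *v y + c k) + dtil P j))"
    by (simp only: state.simps x u matrix_vector_mult_add_rdistrib matrix_sum_mult_vector
        scaleR_matrix_vector_assoc[symmetric] scaleR_add_right sum.distrib)
      (simp add: algebra_simps)
  then show ?thesis
    unfolding feedback_step_split by (simp add: noise_gain_def y_def add.assoc)
qed

context steering_randomness
begin

lemma white_measurable: "i \<in> {0..noise_dim P} \<Longrightarrow> random_variable borel (white k i)"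
  unfolding white_def by (cases "i = 0") (auto intro!: noise_measurable)

text \<open>One step of the stochastic dynamics in the abstract: channel \<open>i\<close> carries an affine image of the
current state with mean \<open>g i\<close>. Only channel \<open>0\<close> contributes to the mean, and the covariances of the
channels add up. A noise channel also contributes \<open>outer (g i)\<close>, because its mean is multiplied
by a random factor, whereas the mean of channel \<open>0\<close> is removed by centring.\<close>
lemma white_sum_moments:
  fixes X :: "'w \<Rightarrow> real^'n" and K :: "nat \<Rightarrow> real^'n^'m" and g :: "nat \<Rightarrow> real^'m"
  assumes X: "square_integrable_rv M X" and Xk: "X \<in> borel_measurable (info k)"
  defines "Y \<equiv> \<lambda>w. \<Sum>i=0..noise_dim P. white k i w *\<^sub>R (K i *v (X w - mean M X) + g i)"
  shows "square_integrable_rv M Y" "mean M Y = g 0"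
    "covariance M Y = (\<Sum>i=0..noise_dim P. congruence (K i) (covariance M X))
       + (\<Sum>i=1..noise_dim P. outer (g i))"
proof -
  let ?m = "noise_dim P"
  define b where "b a i w = K i *v (X w - mean M X) + a i" for a i w
  have b_sq: "square_integrable_rv M (b a i)" for a i
    unfolding b_def by (rule affine_moments(1)[OF X])
  have b_info [measurable]: "b a i \<in> borel_measurable (info k)" for a i
    unfolding b_def using Xk by measurable
  have Y_b: "Y w = (\<Sum>i=0..?m. white k i w *\<^sub>R b g i w)" for w
    by (simp add: Y_def b_def)
  have Y_rv: "random_variable borel Y"
    unfolding Y_b[abs_def]
    by (intro borel_measurable_sum borel_measurable_scaleR white_measurable
        square_integrable_rv_measurable b_sq)
  have "(norm (Y w))\<^sup>2 = (\<Sum>i=0..?m. \<Sum>j=0..?m. white k i w * white k j w * (b g i w \<bullet> b g j w))" for w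
    unfolding power2_norm_eq_inner Y_b inner_sum_left inner_sum_right
    by (intro sum.cong refl) (simp add: inner_commute)
  moreover have "integrable M (\<lambda>w. \<Sum>i=0..?m. \<Sum>j=0..?m.
      white k i w * white k j w * (b g i w \<bullet> b g j w))"
    by (intro expectation_white_form(1) conjI square_integrable_rv_inner_product b_sq) measurable
  ultimately show Y: "square_integrable_rv M Y"
    using Y_rv by (simp add: square_integrable_rv_def)

  have "v \<bullet> mean M Y = v \<bullet> g 0" for v
  proof -
    \<comment> \<open>Restricting the double sum to its row \<open>0\<close>, where \<open>white k 0 = 1\<close>, turns a single sum over the
      channels into a quadratic form.\<close>
    define h where "h i j w = (if i = 0 then v \<bullet> b g j w else 0)" for i j :: nat and w
    have h: "h i j \<in> borel_measurable (info k) \<and> integrable M (h i j)" for i j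
      using square_integrable_rv_integrable[OF b_sq, of g j]
      by (cases "i = 0") (simp_all add: h_def[abs_def] borel_measurable_inner b_info)
    have "v \<bullet> Y w = (\<Sum>i=0..?m. \<Sum>j=0..?m. white k i w * white k j w * h i j w)" for w
    proof -
      have "(\<Sum>i=0..?m. \<Sum>j=0..?m. white k i w * white k j w * h i j w)
          = (\<Sum>i=0..?m. if i = 0 then \<Sum>j=0..?m. white k j w * (v \<bullet> b g j w) else 0)"
        by (intro sum.cong refl) (simp add: h_def white_def)
      then show ?thesis by (simp add: Y_b inner_sum_right)
    qed
    then have "v \<bullet> mean M Y = (\<Sum>i=0..?m. expectation (h i i))"
      using expectation_inner_mean[OF Y, of v] expectation_white_form(2)[OF h] by simp
    also have "\<dots> = expectation (\<lambda>w. v \<bullet> b g 0 w)"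
    proof -
      have "(\<Sum>i=1..?m. expectation (h i i)) = 0"
        by (intro sum.neutral) (simp add: h_def[abs_def])
      then show ?thesis by (simp add: sum_atLeast0_split h_def[abs_def])
    qed
    also have "\<dots> = v \<bullet> g 0"
      using expectation_inner_mean[OF b_sq, of v g 0] affine_moments(2)[OF X, of "K 0" "g 0"]
      by (simp add: b_def[abs_def])
    finally show ?thesis .
  qed
  then show m: "mean M Y = g 0" by (rule vector_eqI_inner)

  \<comment> \<open>The offsets after centring.\<close>
  define g' where "g' = g(0 := 0)"
  have cent: "Y w - mean M Y = (\<Sum>i=0..?m. white k i w *\<^sub>R b g' i w)" for w
    unfolding m Y_b sum_atLeast0_split by (simp add: b_def white_def g'_def)
  have second: "expectation (\<lambda>w. (u \<bullet> b a i w) * (v \<bullet> b a i w))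
      = u \<bullet> ((congruence (K i) (covariance M X) + outer (a i)) *v v)" for u v a i
  proof -
    have c: "square_integrable_rv M (\<lambda>w. K i *v (X w - mean M X))"
      using affine_moments(1)[OF X, of "K i" 0] by simp
    have c0: "mean M (\<lambda>w. K i *v (X w - mean M X)) = 0"
      and cc: "covariance M (\<lambda>w. K i *v (X w - mean M X)) = congruence (K i) (covariance M X)"
      using affine_moments(2,3)[OF X, of "K i" 0] by simp_all
    let ?Z = "\<lambda>w. K i *v (X w - mean M X)"
    have "(u \<bullet> b a i w) * (v \<bullet> b a i w) = (u \<bullet> ?Z w) * (v \<bullet> ?Z w)
        + (v \<bullet> a i) * (u \<bullet> ?Z w) + (u \<bullet> a i) * (v \<bullet> ?Z w) + (u \<bullet> a i) * (v \<bullet> a i)" for w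
      by (simp add: b_def inner_right_distrib algebra_simps)
    moreover have "integrable M (\<lambda>w. (u \<bullet> ?Z w) * (v \<bullet> ?Z w))"
      by (rule square_integrable_rv_product[OF c c])
    moreover have "integrable M (\<lambda>w. x \<bullet> ?Z w)" for x
      using square_integrable_rv_integrable[OF c] by simp
    moreover have "expectation (\<lambda>w. x \<bullet> ?Z w) = 0" for x
      using expectation_inner_mean[OF c, of x] by (simp add: c0)
    ultimately have "expectation (\<lambda>w. (u \<bullet> b a i w) * (v \<bullet> b a i w))
        = expectation (\<lambda>w. (u \<bullet> ?Z w) * (v \<bullet> ?Z w)) + (u \<bullet> a i) * (v \<bullet> a i)"
      by (simp add: prob_space)
    also have "expectation (\<lambda>w. (u \<bullet> ?Z w) * (v \<bullet> ?Z w))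
        = u \<bullet> (congruence (K i) (covariance M X) *v v)"
      using inner_covariance[OF c, of u v] by (simp add: c0 cc)
    finally show ?thesis
      by (simp add: matrix_vector_mult_add_rdistrib inner_right_distrib outer_mult_vector
          inner_commute mult.commute)
  qed
  have "u \<bullet> (covariance M Y *v v)
      = u \<bullet> (((\<Sum>i=0..?m. congruence (K i) (covariance M X)) + (\<Sum>i=1..?m. outer (g i))) *v v)" for u v
  proof -
    have "(u \<bullet> (Y w - mean M Y)) * (v \<bullet> (Y w - mean M Y)) = (\<Sum>i=0..?m. \<Sum>j=0..?m.
        white k i w * white k j w * ((u \<bullet> b g' i w) * (v \<bullet> b g' j w)))" for w
      unfolding cent inner_sum_right sum_product by (intro sum.cong refl) simp
    then have "u \<bullet> (covariance M Y *v v) = expectation (\<lambda>w. \<Sum>i=0..?m. \<Sum>j=0..?m.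
        white k i w * white k j w * ((u \<bullet> b g' i w) * (v \<bullet> b g' j w)))"
      by (simp add: inner_covariance[OF Y])
    also have "\<dots> = (\<Sum>i=0..?m. expectation (\<lambda>w. (u \<bullet> b g' i w) * (v \<bullet> b g' i w)))"
      by (intro expectation_white_form(2) conjI square_integrable_rv_product b_sq) measurable
    also have "\<dots> = u \<bullet> ((\<Sum>i=0..?m. congruence (K i) (covariance M X) + outer (g' i)) *v v)"
      unfolding second matrix_sum_mult_vector inner_sum_right ..
    also have "(\<Sum>i=0..?m. congruence (K i) (covariance M X) + outer (g' i))
        = (\<Sum>i=0..?m. congruence (K i) (covariance M X)) + (\<Sum>i=1..?m. outer (g i))"
    proof -
      have "outer (g' 0) = 0" by (simp add: g'_def outer_def vec_eq_iff)
      moreover have "(\<Sum>i=1..?m. outer (g' i)) = (\<Sum>i=1..?m. outer (g i))"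
        by (intro sum.cong refl) (simp add: g'_def)
      ultimately show ?thesis
        by (simp add: sum.distrib sum_atLeast0_split[of "\<lambda>i. outer (g' i)"])
    qed
    finally show ?thesis .
  qed
  then show "covariance M Y = (\<Sum>i=0..?m. congruence (K i) (covariance M X))
       + (\<Sum>i=1..?m. outer (g i))"
    by (rule matrix_eqI_inner)
qed

lemma square_integrable_rv_cong:
  "(\<And>w. w \<in> space M \<Longrightarrow> X w = Y w) \<Longrightarrow> square_integrable_rv M X \<longleftrightarrow> square_integrable_rv M Y"
  unfolding square_integrable_rv_def
  by (intro conj_cong measurable_cong Bochner_Integration.integrable_cong) auto

lemma mean_cong: "(\<And>w. w \<in> space M \<Longrightarrow> X w = Y w) \<Longrightarrow> mean M X = mean M Y"
  unfolding mean_def by (intro Bochner_Integration.integral_cong) auto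

lemma covariance_cong:
  assumes "\<And>w. w \<in> space M \<Longrightarrow> X w = Y w"
  shows "covariance M X = covariance M Y"
proof -
  have "mean M X = mean M Y" by (rule mean_cong) (rule assms)
  then show ?thesis
    unfolding covariance_def by (intro Bochner_Integration.integral_cong) (simp_all add: assms)
qed

text \<open>The recursions \<open>xbar\<close> and \<open>covD\<close> are the exact moment recursions of the closed loop. The induction
must carry measurability with respect to \<open>info k\<close> along, since this is what makes the state
independent of the next noises.\<close>
lemma feedback_state_moments:
  assumes I: "psd (\<Sigma>I P)"
    and u: "\<And>k w. k < n \<Longrightarrow> w \<in> space M \<Longrightarrow>
      u k w = L k *v (state P x0 q u k w - xbar P c k) + c k"
  shows "k \<le> n \<Longrightarrow> state P x0 q u k \<in> borel_measurable (info k) \<and>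
    square_integrable_rv M (state P x0 q u k) \<and>
    mean M (state P x0 q u k) = xbar P c k \<and>
    covariance M (state P x0 q u k) = covD P c L k"
proof (induction k)
  case 0
  then show ?case
    by (simp add: x0_measurable_info x0_square_integrable mean_x0 covariance_x0)
next
  case (Suc k)
  let ?X = "state P x0 q u k"
  define K where "K i = (if i = 0 then Abar P + Bbar P ** L k else Atil P i + Btil P i ** L k)" for i
  define g where "g i = (if i = 0 then xbar P c (Suc k) else noise_gain P c i k)" for i
  define Y where "Y w = (\<Sum>i=0..noise_dim P. white k i w *\<^sub>R (K i *v (?X w - mean M ?X) + g i))" for w
  have k: "k < n" using Suc.prems by simp
  with Suc.IH have Xk [measurable]: "?X \<in> borel_measurable (info k)"
    and X: "square_integrable_rv M ?X" and m: "mean M ?X = xbar P c k"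
    and C: "covariance M ?X = covD P c L k" by auto
  have eq: "state P x0 q u (Suc k) w = Y w" if "w \<in> space M" for w
  proof -
    have "Y w = K 0 *v (?X w - xbar P c k) + g 0
        + (\<Sum>i=1..noise_dim P. q i k w *\<^sub>R (K i *v (?X w - xbar P c k) + g i))"
      unfolding Y_def sum_atLeast0_split m by (simp add: white_def)
    also have "\<dots> = state P x0 q u (Suc k) w"
      unfolding state_Suc_feedback[OF u[OF k that]]
      by (intro arg_cong2[where f = "(+)"] sum.cong) (simp_all add: K_def g_def)
    finally show ?thesis by simp
  qed
  have cong: "square_integrable_rv M (state P x0 q u (Suc k)) \<longleftrightarrow> square_integrable_rv M Y"
    "mean M (state P x0 q u (Suc k)) = mean M Y"
    "covariance M (state P x0 q u (Suc k)) = covariance M Y"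
    by (intro square_integrable_rv_cong mean_cong covariance_cong eq; assumption)+
  note moments = white_sum_moments[OF X Xk, of K g, folded Y_def]
  have Xk': "?X \<in> borel_measurable (info (Suc k))"
    by (rule measurable_from_subalg[OF subalgebra_info_Suc Xk])
  have wk: "white k i \<in> borel_measurable (info (Suc k))" if "i \<in> {0..noise_dim P}" for i
    using that unfolding white_def by (cases "i = 0") (auto intro!: noise_measurable_info)
  have "(\<lambda>w. K i *v (?X w - mean M ?X) + g i) \<in> borel_measurable (info (Suc k))" for i
    using Xk' by measurable
  then have "Y \<in> borel_measurable (info (Suc k))"
    unfolding Y_def[abs_def] using wk by (intro borel_measurable_sum borel_measurable_scaleR)
  then have meas: "state P x0 q u (Suc k) \<in> borel_measurable (info (Suc k))"
    by (subst measurable_cong[of _ _ Y]) (simp_all only: space_info eq)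
  have "covariance M (state P x0 q u (Suc k)) = covD P c L (Suc k)"
    unfolding cong(3) moments(3) C covD_Suc_closed_loop[OF I] closed_loop_step_def
      sum_atLeast0_split[of "\<lambda>i. congruence (K i) (covD P c L k)"]
    by (intro arg_cong2[where f = "(+)"] sum.cong) (simp_all add: K_def g_def)
  moreover have "mean M (state P x0 q u (Suc k)) = xbar P c (Suc k)"
    unfolding cong(2) moments(2) by (simp add: g_def)
  moreover have "square_integrable_rv M (state P x0 q u (Suc k))"
    using moments(1) cong(1) by blast
  ultimately show ?case using meas by blast
qed

text \<open>Once \<open>xbar\<close>, \<open>covD\<close> and \<open>covDu\<close> are identified as the actual moments of state and input, every
deterministic constraint is the Cantelli bound for the corresponding half-space, and the terminal
conditions of the two problems coincide.\<close>
theorem feedback_feasible_S: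
  assumes data: "valid_data P" and feas: "feasible_D rel P c L"
    and u: "\<And>k w. k < horizon P \<Longrightarrow> w \<in> space M \<Longrightarrow>
      u k w = L k *v (state P x0 q u k w - xbar P c k) + c k"
  shows "feasible_S rel P M x0 q u"
proof -
  have I: "psd (\<Sigma>I P)"
    using data by (simp add: valid_data_def pos_def_imp_psd)
  note px = prisk_in_unit_interval(1)[OF data] and pu = prisk_in_unit_interval(2)[OF data]
  let ?x = "state P x0 q u"
  have x_info: "?x k \<in> borel_measurable (info k)" and x_sq: "square_integrable_rv M (?x k)"
    and x_mean: "mean M (?x k) = xbar P c k" and x_cov: "covariance M (?x k) = covD P c L k"
    if "k \<le> horizon P" for k
    using feedback_state_moments[OF I u that] by auto
  have u_info: "u k \<in> borel_measurable (info k)" and u_sq: "square_integrable_rv M (u k)"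
    and u_mean: "mean M (u k) = c k" and u_cov: "covariance M (u k) = covDu P c L k"
    if k: "k < horizon P" for k
  proof -
    let ?v = "\<lambda>w. L k *v (?x k w - mean M (?x k)) + c k"
    have k': "k \<le> horizon P" using k by simp
    have eq: "u k w = ?v w" if "w \<in> space M" for w
      using u[OF k that] by (simp add: x_mean[OF k'])
    have cong: "square_integrable_rv M (u k) \<longleftrightarrow> square_integrable_rv M ?v"
      "mean M (u k) = mean M ?v" "covariance M (u k) = covariance M ?v"
      by (intro square_integrable_rv_cong mean_cong covariance_cong eq; assumption)+
    note v = affine_moments[OF x_sq[OF k'], of "L k" "c k"]
    have "?v \<in> borel_measurable (info k)"
      using x_info[OF k'] by measurable
    then show "u k \<in> borel_measurable (info k)"
      by (subst measurable_cong[of _ _ ?v]) (simp_all only: space_info eq)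
    show "square_integrable_rv M (u k)" using v(1) cong(1) by blast
    show "mean M (u k) = c k" unfolding cong(2) v(2) ..
    show "covariance M (u k) = covDu P c L k"
      unfolding cong(3) v(3) x_cov[OF k'] covDu_def congruence_def ..
  qed
  have "1 - risk_x P \<le> prob {w \<in> space M. ?x k w \<in> state_set P}" if k: "k < horizon P" for k
    unfolding state_set_def
  proof (rule chance_constraint_polyhedron)
    show "random_variable borel (?x k)"
      using k by (intro square_integrable_rv_measurable x_sq) simp
    show "(\<Sum>i=1..num_x P. prisk_x P i) \<le> risk_x P" using data by (simp add: valid_data_def)
    fix i assume i: "i \<in> {1..num_x P}"
    show "prob {w \<in> space M. \<beta>x P i < \<alpha>x P i \<bullet> ?x k w} \<le> prisk_x P i"
      using feas k i px[OF i]
      by (intro chance_constraint_halfspace x_sq) (simp_all add: x_mean x_cov feasible_D_def)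
  qed
  moreover have "1 - risk_u P \<le> prob {w \<in> space M. u k w \<in> input_set P}" if k: "k < horizon P" for k
    unfolding input_set_def
  proof (rule chance_constraint_polyhedron)
    show "random_variable borel (u k)"
      using k by (intro square_integrable_rv_measurable u_sq)
    show "(\<Sum>i=1..num_u P. prisk_u P i) \<le> risk_u P" using data by (simp add: valid_data_def)
    fix i assume i: "i \<in> {1..num_u P}"
    show "prob {w \<in> space M. \<beta>u P i < \<alpha>u P i \<bullet> u k w} \<le> prisk_u P i"
      using feas k i pu[OF i]
      by (intro chance_constraint_halfspace u_sq) (simp_all add: u_mean u_cov feasible_D_def)
  qed
  ultimately show ?thesis
    using feas u_info u_sq
    by (simp add: feasible_S_def feasible_D_def initial_state_law_def x0_square_integrable
        mean_x0 covariance_x0 x_sq x_mean x_cov)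
qed

end

section \<open>The relaxed solution is feasible\<close>

theorem theorem2:
  fixes P :: "('x::finite, 'u::finite) steering_data"
    and M :: "'w measure"
    and x0 :: "'w \<Rightarrow> real^'x"
    and q :: "nat \<Rightarrow> nat \<Rightarrow> 'w \<Rightarrow> real"
    and c :: "nat \<Rightarrow> real^'u"
    and Sux :: "nat \<Rightarrow> real^'x^'u"
    and Su :: "nat \<Rightarrow> real^'u^'u"
    and S :: "nat \<Rightarrow> nat \<Rightarrow> real^'x^'x"
    and L :: "nat \<Rightarrow> real^'x^'u"
    and xs xtil :: "nat \<Rightarrow> 'w \<Rightarrow> real^'x"
    and us :: "nat \<Rightarrow> 'w \<Rightarrow> real^'u"
    and xm :: "nat \<Rightarrow> real^'x"
    and um :: "nat \<Rightarrow> real^'u"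
  assumes "valid_data P"
    and "valid_randomness P M x0 q"
    and "optimal_C P c Sux Su S"
    and "\<And>k. k < horizon P \<Longrightarrow> L k = Sux k ** matrix_inv (covC P Sux Su S k)"
    and "\<And>w. w \<in> space M \<Longrightarrow> xtil 0 w = x0 w - \<mu>I P"
    and "\<And>w. w \<in> space M \<Longrightarrow> xs 0 w = x0 w"
    and "xm 0 = \<mu>I P"
    and "\<And>k w. k < horizon P \<Longrightarrow> w \<in> space M \<Longrightarrow> us k w = L k *v xtil k w + c k"
    and "\<And>k w. k < horizon P \<Longrightarrow> w \<in> space M \<Longrightarrow>
          xtil (Suc k) w = (Abar P + Bbar P ** L k) *v xtil k w
            + (\<Sum>j=1..noise_dim P. q j k w *\<^sub>R (Atil P j *v xs k w))
            + (\<Sum>j=1..noise_dim P. q j k w *\<^sub>R (Btil P j *v us k w))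
            + (\<Sum>j=1..noise_dim P. q j k w *\<^sub>R dtil P j)"
    and "\<And>k w. k < horizon P \<Longrightarrow> w \<in> space M \<Longrightarrow>
          xs (Suc k) w = (Abar P + (\<Sum>j=1..noise_dim P. q j k w *\<^sub>R Atil P j)) *v xs k w
            + (Bbar P + (\<Sum>j=1..noise_dim P. q j k w *\<^sub>R Btil P j)) *v us k w
            + dbar P + (\<Sum>j=1..noise_dim P. q j k w *\<^sub>R dtil P j)"
    and "\<And>k. k < horizon P \<Longrightarrow> um k = c k"
    and "\<And>k. k < horizon P \<Longrightarrow> xm (Suc k) = Abar P *v xm k + Bbar P *v um k + dbar P"
  shows "feasible_D loewner_le P c L \<and> feasible_S loewner_le P M x0 q us"
proof -
  interpret prob_space M using assms(2) by (simp add: valid_randomness_def)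
  interpret steering_randomness M P x0 q by unfold_locales (rule assms(2))
  have "feasible_C P c Sux Su S" using assms(3) by (simp add: optimal_C_def)
  then have D: "feasible_D loewner_le P c L"
    by (rule feasible_C_imp_feasible_D[OF assms(1) _ assms(4)])
  \<comment> \<open>The trajectory in the hypotheses is the one generated by \<open>us\<close>, and its zero-mean part is the
    deviation from \<open>xbar\<close>, so that \<open>us\<close> is a feedback policy of the form treated above.\<close>
  have xs: "xs k w = state P x0 q us k w" if w: "w \<in> space M" and "k \<le> horizon P" for k w
    using that(2) by (induction k) (simp_all add: assms(6,10) w)
  have xtil: "xtil k w = xs k w - xbar P c k" if w: "w \<in> space M" and "k \<le> horizon P" for k w
    using that(2)
  proof (induction k)
    case 0
    then show ?case by (simp add: assms(5,6) w)
  next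
    case (Suc k)
    then have k: "k < horizon P" and IH: "xtil k w = xs k w - xbar P c k" by auto
    have "xs (Suc k) w - xbar P c (Suc k)
        = Abar P *v xtil k w + Bbar P *v (L k *v xtil k w)
          + (\<Sum>j=1..noise_dim P. q j k w *\<^sub>R (Atil P j *v xs k w))
          + (\<Sum>j=1..noise_dim P. q j k w *\<^sub>R (Btil P j *v us k w))
          + (\<Sum>j=1..noise_dim P. q j k w *\<^sub>R dtil P j)"
      unfolding assms(10)[OF k w] matrix_vector_mult_add_rdistrib matrix_sum_mult_vector
        scaleR_matrix_vector_assoc[symmetric]
      by (simp add: assms(8)[OF k w] IH matrix_vector_right_distrib
          matrix_vector_mult_diff_distrib)
    also have "\<dots> = xtil (Suc k) w"
      unfolding assms(9)[OF k w]
      by (simp add: matrix_vector_mult_add_rdistrib matrix_vector_mul_assoc)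
    finally show ?case by simp
  qed
  have "feasible_S loewner_le P M x0 q us"
  proof (rule feedback_feasible_S[OF assms(1) D])
    fix k w assume "k < horizon P" "w \<in> space M"
    then show "us k w = L k *v (state P x0 q us k w - xbar P c k) + c k"
      using assms(8) xtil[of w k] xs[of w k] by simp
  qed
  with D show ?thesis by blast
qed

end
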